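(* Let $X$ be a minimal finite-velocity random motion in $\mathbb{R}^D$ with affinely independent velocities $v_0,\dots,v_D$, satisfying the two assumptions: changes of velocity depend only on the previously selected velocities; displacement durations relative to different velocities are independent (both made precise in the context). For each $h$ and $n\ge 1$ let $f_{\sum_{j=1}^{n}W^{(h)}_j}$ denote the probability density of $\sum_{j=1}^{n}W^{(h)}_j$. Let $t\ge 0$, let $x$ be an interior point of $\mathrm{Supp}(X(t))=\mathrm{Conv}(v_0t,\dots,v_Dt)$, let $n_0,\dots,n_D\ge 1$ be integers, put $n=n_0+\dots+n_D$, and let $k\in\{0,\dots,D\}$. Then $$P\Big\{X(t)\in dx,\ \bigcap_{h=0}^D\{N_h(t)=n_h\},\ V(t)=v_k\Big\}$$ $$=\prod_{\substack{h=0\\ h\ne k}}^D f_{\sum_{j=1}^{n_h}W_j^{(h)}}\big(g_{k,h}^{-1}(x)\big)\,dx\ \Big|\det\big[v_h-v_k\big]_{h\neq k}\Big|^{-1}\ P\Big\{N_{(k)}\Big(t-\sum_{\substack{h=0\\ h\neq k}}^D g_{k,h}^{-1}(x)\Big)=n_k-1\Big\}$$ $$\times\ P\big\{C_{n}=(n_0,\dots,n_D),\ V(T_{n-1})=v_k\big\},$$ where $g_k^{-1}(x)=\big(g_{k,h}^{-1}(x)\big)_{h\ne k}=\big[v_h-v_k\big]_{h\ne k}^{-1}(x-v_kt)$.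
   Context: Random motion. Let $(W_n)_{n\ge 0}$ be random variables with $W_n\ge 0$ a.s. and $W_0=0$ a.s., let $T_n=\sum_{i=0}^n W_i$ and $N(t)=\max\{n\ge 0:\ T_n\le t\}$, with $N(t)<\infty$ a.s. for all $t\ge 0$. Let $V=\{V(t)\}_{t\ge 0}$ take values in a finite set of velocities in $\mathbb{R}^D$ and change value only when $N$ records an event, so $V(t)=V(T_{N(t)})$. The random motion with velocity $V$ governed by $N$ is $X(t)=\int_0^tV(s)\,ds=\sum_{i=0}^{N(t)-1}(T_{i+1}-T_i)V(T_i)+(t-T_{N(t)})V(T_{N(t)})$. It is called minimal in $\mathbb{R}^D$ if it moves with $D+1$ affinely independent velocities $v_0,\dots,v_D\in\mathbb{R}^D$. Notation. $[v_h-v_k]_{h\neq k}$ is the $D\times D$ matrix with columns $v_h-v_k$, $h\in\{0,\dots,D\}\setminus\{k\}$. $N_h(t)=|\{0\le j\le N(t):V(T_j)=v_h\}|$ counts the displacements with velocity $v_h$ in $[0,t]$ (including the current, incomplete one), so $\sum_hN_h(t)=N(t)+1$. For $n\ge 1$, $C_n=(C_{n,0},\dots,C_{n,D})$ with $C_{n,h}=|\{0\le j\le n-1: V(T_j)=v_h\}|$ is the allocation of velocities among the first $n$ displacements. $W^{(h)}_m$ is the duration of the $m$-th displacement with velocity $v_h$ (if $V(T_n)=v_h$ and this is the $m$-th selection of $v_h$ then $W_{n+1}=W^{(h)}_m$), and $N_{(h)}(s)=\max\{n\ge 0:\sum_{i=1}^nW_i^{(h)}\le s\}$, $s\ge0$,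 is the associated point process. Assumptions. (1) The changes of velocity, which can only occur when $N$ records an event, depend only on the previously selected velocities, not on the switching instants nor on the times spent with each velocity: with $\mathcal{F}_t$ the filtration to which all processes are adapted, $P\{V(t+dt)=v_h\mid N(t,t+dt]=1,\mathcal{F}_t\}=P\{V(t+dt)=v_h\mid N(t,t+dt]=1,\ V(T_j),\ j=0,\dots,N(t)\}$. Consequently the displacement durations $W^{(h)}_m$ are independent of the allocation of the velocities among the steps, i.e. the family $(W^{(h)}_m)_{h,m}$ is independent of the sequence $(V(T_n))_{n\ge0}$. (2) The sequences $(W^{(0)}_m)_{m\ge1},\dots,(W^{(D)}_m)_{m\ge1}$ are independent of each other (durations with the same velocity may be dependent); hence $N_{(0)},\dots,N_{(D)}$ are independent. The sums $\sum_{j=1}^nW^{(h)}_j$, $n\ge1$, are assumed absolutely continuous. The identity $P\{X(t)\in dx,\dots\}=(\cdots)\,dx$ means that the corresponding measure on the interior of the support has the stated density. *)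

theory Defs
  imports "HOL-Probability.Probability"
begin

definition event_time :: "(nat \<Rightarrow> 'a \<Rightarrow> real) \<Rightarrow> nat \<Rightarrow> 'a \<Rightarrow> real" where
  "event_time W n \<omega> = (\<Sum>i\<le>n. W i \<omega>)"

text \<open>The largest \<open>n\<close> with \<open>S n \<omega> \<le> s\<close>, for a nondecreasing sequence \<open>S\<close> of event times. The value is
  \<open>\<infinity>\<close> if there is no largest one.\<close>

definition counting :: "(nat \<Rightarrow> 'a \<Rightarrow> real) \<Rightarrow> real \<Rightarrow> 'a \<Rightarrow> enat" where
  "counting S s \<omega> = Sup (enat ` {n. S n \<omega> \<le> s})"

definition event_count :: "(nat \<Rightarrow> 'a \<Rightarrow> real) \<Rightarrow> real \<Rightarrow> 'a \<Rightarrow> enat" where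
  "event_count W = counting (event_time W)"

text \<open>\<open>U h m\<close> stands for the duration \<open>W\<^sup>(\<^sup>h\<^sup>)\<^sub>m\<close> of the \<open>m\<close>-th displacement with velocity \<open>v h\<close>
  (\<open>m \<ge> 1\<close>; the values \<open>U h 0\<close> are never used).\<close>

definition duration_sum :: "(nat \<Rightarrow> nat \<Rightarrow> 'a \<Rightarrow> real) \<Rightarrow> nat \<Rightarrow> nat \<Rightarrow> 'a \<Rightarrow> real" where
  "duration_sum U h n \<omega> = (\<Sum>j=1..n. U h j \<omega>)"

definition duration_count :: "(nat \<Rightarrow> nat \<Rightarrow> 'a \<Rightarrow> real) \<Rightarrow> nat \<Rightarrow> real \<Rightarrow> 'a \<Rightarrow> enat" where
  "duration_count U h = counting (duration_sum U h)"

definition position :: "(real \<Rightarrow> 'a \<Rightarrow> real^'n) \<Rightarrow> real \<Rightarrow> 'a \<Rightarrow> real^'n" where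
  "position V t \<omega> = integral {0..t} (\<lambda>s. V s \<omega>)"

definition step_velocity ::
    "(nat \<Rightarrow> 'a \<Rightarrow> real) \<Rightarrow> (real \<Rightarrow> 'a \<Rightarrow> real^'n) \<Rightarrow> nat \<Rightarrow> 'a \<Rightarrow> real^'n" where
  "step_velocity W V j \<omega> = V (event_time W j \<omega>) \<omega>"

text \<open>\<open>N\<^sub>h(t)\<close> is \<open>displacements W V (v h) t\<close>, and \<open>C\<^sub>n\<^sub>,\<^sub>h\<close> is \<open>allocation W V (v h) n\<close>.\<close>

definition displacements ::
    "(nat \<Rightarrow> 'a \<Rightarrow> real) \<Rightarrow> (real \<Rightarrow> 'a \<Rightarrow> real^'n) \<Rightarrow> real^'n \<Rightarrow> real \<Rightarrow> 'a \<Rightarrow> nat" where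
  "displacements W V u t \<omega> = card {j. enat j \<le> event_count W t \<omega> \<and> step_velocity W V j \<omega> = u}"

definition allocation ::
    "(nat \<Rightarrow> 'a \<Rightarrow> real) \<Rightarrow> (real \<Rightarrow> 'a \<Rightarrow> real^'n) \<Rightarrow> real^'n \<Rightarrow> nat \<Rightarrow> 'a \<Rightarrow> nat" where
  "allocation W V u n \<omega> = card {j. j < n \<and> step_velocity W V j \<omega> = u}"

text \<open>Independence of the sigma-algebras generated by \<open>X\<close> and \<open>Y\<close>. The library's \<open>indep_var\<close> requires
  both random elements to take values in the same type.\<close>

definition (in prob_space) indep_elements ::
    "'b measure \<Rightarrow> ('a \<Rightarrow> 'b) \<Rightarrow> 'c measure \<Rightarrow> ('a \<Rightarrow> 'c) \<Rightarrow> bool" where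
  "indep_elements M1 X M2 Y \<longleftrightarrow>
     X \<in> measurable M M1 \<and> Y \<in> measurable M M2 \<and>
     indep_set {X -` A \<inter> space M | A. A \<in> sets M1} {Y -` A \<inter> space M | A. A \<in> sets M2}"

text \<open>Here \<open>D = CARD('n)\<close> and the velocities are \<open>v 0, \<dots>, v D\<close>. The random variables are functions on
  the sample space, and the almost sure path properties leave them unrestricted on a null set; hence the
  measurability of \<open>V t\<close> and of the position is stated explicitly.\<close>

locale minimal_random_motion = prob_space M
  for M :: "'a measure"
    and v :: "nat \<Rightarrow> real^'n"
    and W :: "nat \<Rightarrow> 'a \<Rightarrow> real"
    and V :: "real \<Rightarrow> 'a \<Rightarrow> real^'n" +
  assumes W_measurable: "\<And>n. random_variable borel (W n)"
    and W_nonneg: "\<And>n. AE \<omega> in M. 0 \<le> W n \<omega>"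
    and W_0: "AE \<omega> in M. W 0 \<omega> = 0"
    and event_count_finite: "\<And>t. 0 \<le> t \<Longrightarrow> AE \<omega> in M. event_count W t \<omega> < \<infinity>"
    and v_inj: "inj_on v {..CARD('n)}"
    and v_affine_independent: "\<not> affine_dependent (v ` {..CARD('n)})"
    and V_measurable: "\<And>t. 0 \<le> t \<Longrightarrow> random_variable borel (V t)"
    and V_values: "AE \<omega> in M. \<forall>t\<ge>0. V t \<omega> \<in> v ` {..CARD('n)}"
    and V_step: "AE \<omega> in M. \<forall>t\<ge>0. V t \<omega> = step_velocity W V (the_enat (event_count W t \<omega>)) \<omega>"
    and position_measurable: "\<And>t. 0 \<le> t \<Longrightarrow> random_variable borel (position V t)"

text \<open>In \<open>U_duration\<close>, \<open>allocation W V (v h) (Suc j) \<omega> = m\<close> says that, if the velocity at the \<open>j\<close>-th event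
  is \<open>v h\<close>, this is the \<open>m\<close>-th selection of \<open>v h\<close>.\<close>

locale minimal_random_motion_independent = minimal_random_motion M v W V
  for M :: "'a measure"
    and v :: "nat \<Rightarrow> real^'n"
    and W :: "nat \<Rightarrow> 'a \<Rightarrow> real"
    and V :: "real \<Rightarrow> 'a \<Rightarrow> real^'n"
    and U :: "nat \<Rightarrow> nat \<Rightarrow> 'a \<Rightarrow> real" +
  assumes U_nonneg: "\<And>h m. h \<le> CARD('n) \<Longrightarrow> 1 \<le> m \<Longrightarrow> AE \<omega> in M. 0 \<le> U h m \<omega>"
    and U_duration: "\<And>h j m. h \<le> CARD('n) \<Longrightarrow> AE \<omega> in M.
      step_velocity W V j \<omega> = v h \<and> allocation W V (v h) (Suc j) \<omega> = m \<longrightarrow> W (Suc j) \<omega> = U h m \<omega>"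
    and durations_indep_velocities:
      "indep_elements
         (\<Pi>\<^sub>M (h, m)\<in>{..CARD('n)} \<times> {1..}. borel)
         (\<lambda>\<omega>. \<lambda>(h, m)\<in>{..CARD('n)} \<times> {1..}. U h m \<omega>)
         (\<Pi>\<^sub>M j\<in>UNIV. borel)
         (\<lambda>\<omega> j. step_velocity W V j \<omega>)"
    and durations_indep:
      "indep_vars (\<lambda>h. \<Pi>\<^sub>M m\<in>{1..}. borel) (\<lambda>h \<omega>. \<lambda>m\<in>{1..}. U h m \<omega>) {..CARD('n)}"

text \<open>The matrix with columns \<open>v h - v k\<close>, \<open>h \<noteq> k\<close>. The bijection \<open>e\<close> from the column index type onto
  \<open>{0, \<dots>, D} - {k}\<close> fixes the order of the columns, and column \<open>e\<^sup>-\<^sup>1(h)\<close> belongs to \<open>h\<close>.\<close>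

definition velocity_matrix :: "(nat \<Rightarrow> real^'n) \<Rightarrow> nat \<Rightarrow> ('n \<Rightarrow> nat) \<Rightarrow> real^'n^'n" where
  "velocity_matrix v k e = (\<chi> i j. (v (e j) - v k) $ i)"

definition g_inv ::
    "(nat \<Rightarrow> real^'n) \<Rightarrow> nat \<Rightarrow> ('n \<Rightarrow> nat) \<Rightarrow> real \<Rightarrow> nat \<Rightarrow> real^'n \<Rightarrow> real" where
  "g_inv v k e t h x =
     (matrix_inv (velocity_matrix v k e) *v (x - t *\<^sub>R v k)) $ (inv_into UNIV e h)"

end

theory Submission imports Defs begin

text \<open>
  On almost every trajectory the event of the theorem can be read off from two independent sources of
  randomness. If the counts \<open>N\<^sub>h(t) = n\<^sub>h\<close> hold, then their sum \<open>n\<close> is \<open>N(t) + 1\<close>, so the current step has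
  index \<open>n - 1\<close>; hence the first \<open>n\<close> selected velocities have allocation \<open>(n\<^sub>0, \<dots>, n\<^sub>D)\<close>, and the last of
  them is \<open>v\<^sub>k\<close>. Once this is known, sorting the displacements by velocity shows that only the total
  durations matter (\<open>sum_steps_by_velocity\<close>): with \<open>S\<^sub>h\<close> the sum of the first \<open>n\<^sub>h\<close> durations with velocity
  \<open>v\<^sub>h\<close>, the position is \<open>t v\<^sub>k + \<Sum>\<^sub>h S\<^sub>h (v\<^sub>h - v\<^sub>k)\<close>, the sum being over \<open>h \<noteq> k\<close>, and step \<open>n - 1\<close> is in
  progress at time \<open>t\<close> if and only if the remaining time \<open>t - \<Sum>\<^sub>h S\<^sub>h\<close> falls into the \<open>n\<^sub>k\<close>-th displacement
  with velocity \<open>v\<^sub>k\<close>. This equivalence is \<open>motion_event_iff\<close>.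

  Durations are independent of the selected velocities, so the probability of the allocation splits off
  as a factor (\<open>prob_motion_event\<close>). The vector \<open>Y = (S\<^sub>h)\<close>, \<open>h \<noteq> k\<close>, has independent components and
  therefore the product of the given densities as its density, and it is independent of the durations
  with velocity \<open>v\<^sub>k\<close>. By Fubini the condition on the latter can be replaced by its probability, evaluated
  at the remaining time (\<open>prob_durations_density\<close>).

  Finally, the position is an affine image of \<open>Y\<close> under the matrix with columns \<open>v\<^sub>h - v\<^sub>k\<close>, which is
  invertible by affine independence. The change of variables (\<open>nn_integral_lborel_affine\<close>) produces the
  factor \<open>|det|\<^sup>-\<^sup>1\<close> and the inverse \<open>g\<^sub>k\<^sup>-\<^sup>1\<close>. Points in the convex hull of the \<open>t v\<^sub>h\<close> leave a nonnegative
  remaining time (\<open>convex_hull_coordinates\<close>), and for those times the probability that the remaining time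
  falls into the \<open>n\<^sub>k\<close>-th displacement is that of \<open>N\<^sub>(\<^sub>k\<^sub>) = n\<^sub>k - 1\<close>.
\<close>

section \<open>Linear change of variables and densities of random vectors\<close>

lemma bij_betw_axis_Basis: "bij_betw (\<lambda>i. axis i (1::real)) UNIV (Basis :: (real^'n) set)"
  by (auto simp: bij_betw_def inj_def axis_eq_axis Basis_vec_def)

lemma prod_Basis_vec:
  "(\<Prod>b\<in>Basis. h b) = (\<Prod>i\<in>UNIV. h (axis i (1::real) :: real^'n))"
  by (rule prod.reindex_bij_betw[OF bij_betw_axis_Basis, symmetric])

lemma sum_Basis_vec:
  "(\<Sum>b\<in>Basis. h b) = (\<Sum>i\<in>UNIV. h (axis i (1::real) :: real^'n))"
  by (rule sum.reindex_bij_betw[OF bij_betw_axis_Basis, symmetric])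

lemma measurable_vec_lambda [measurable (raw)]:
  fixes f :: "'n::finite \<Rightarrow> 'a \<Rightarrow> real"
  assumes "\<And>i. f i \<in> borel_measurable N"
  shows "(\<lambda>z. \<chi> i. f i z) \<in> borel_measurable N"
proof (subst borel_measurable_euclidean_space, intro ballI)
  fix b :: "real^'n" assume "b \<in> Basis"
  then obtain i where "b = axis i 1"
    by (auto simp: Basis_vec_def)
  then show "(\<lambda>z. (\<chi> i. f i z) \<bullet> b) \<in> borel_measurable N"
    using assms by (simp add: inner_axis)
qed

lemma measurable_vec_nth [measurable (raw)]:
  assumes "f \<in> borel_measurable N"
  shows "(\<lambda>z. f z $ i) \<in> borel_measurable N"
  by (rule measurable_compose[OF assms], rule borel_measurable_continuous_onI)
    (intro continuous_intros)

lemma measurable_matrix_vector_mult [measurable (raw)]: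
  fixes A :: "real^'n^'m"
  assumes "f \<in> borel_measurable N"
  shows "(\<lambda>z. A *v f z) \<in> borel_measurable N"
  by (rule measurable_compose[OF assms], rule borel_measurable_continuous_onI)
    (rule matrix_vector_mult_linear_continuous_on)

text \<open>Coordinates indexed by the type itself, instead of by the standard basis, are the form in which
  the joint law of a family of real random variables is given.\<close>

lemma lborel_vec_eq_distr_PiM:
  "(lborel :: (real^'n) measure) = distr (\<Pi>\<^sub>M i\<in>(UNIV :: 'n set). lborel) borel (\<lambda>z. \<chi> i. z i)"
proof (rule lborel_eqI)
  interpret product_sigma_finite "\<lambda>i::'n. lborel :: real measure"
    by standard
  fix l u :: "real^'n" assume le: "\<And>b. b \<in> Basis \<Longrightarrow> l \<bullet> b \<le> u \<bullet> b"
  have le': "l $ i \<le> u $ i" for i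
    using le[of "axis i 1"] by (simp add: inner_axis axis_in_Basis_iff)
  have [measurable]: "(\<lambda>z. \<chi> i. z i) \<in> (\<Pi>\<^sub>M i\<in>(UNIV :: 'n set). lborel) \<rightarrow>\<^sub>M (borel :: (real^'n) measure)"
    by (rule measurable_vec_lambda) simp
  have *: "(\<lambda>z. \<chi> i. z i) -` box l u \<inter> space (\<Pi>\<^sub>M i\<in>(UNIV :: 'n set). lborel)
      = PiE UNIV (\<lambda>i. {l $ i <..< u $ i})"
    by (auto simp: space_PiM mem_box_cart PiE_iff)
  show "emeasure (distr (\<Pi>\<^sub>M i\<in>(UNIV :: 'n set). lborel) borel (\<lambda>z. \<chi> i. z i)) (box l u)
      = (\<Prod>b\<in>Basis. (u - l) \<bullet> b)"
    by (subst emeasure_distr, measurable, unfold * prod_Basis_vec, subst emeasure_PiM)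
      (auto simp: le' inner_axis prod_ennreal)
qed simp

lemma nn_integral_lborel_vec:
  fixes g :: "real^'n \<Rightarrow> ennreal"
  assumes "g \<in> borel_measurable borel"
  shows "(\<integral>\<^sup>+x. g x \<partial>lborel) = (\<integral>\<^sup>+z. g (\<chi> i. z i) \<partial>(\<Pi>\<^sub>M i\<in>UNIV. lborel))"
  using assms by (subst lborel_vec_eq_distr_PiM) (simp add: nn_integral_distr)

text \<open>It suffices to treat the elementary matrices, because the identities for two matrices compose to
  the one for their product. Matrices with a zero row are excluded by the determinant, diagonal ones
  rescale the axes and swaps permute the factors of a product measure. For a shear
  \<open>x\<^sub>m \<mapsto> x\<^sub>m + c x\<^sub>n\<close> one integrates first over \<open>x\<^sub>m\<close>: with the other coordinates fixed, it is a
  translation of the line.\<close>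

lemma nn_integral_lborel_linear:
  fixes A :: "real^'n^'n" and g :: "real^'n \<Rightarrow> ennreal"
  assumes "det A \<noteq> 0" and "g \<in> borel_measurable borel"
  shows "(\<integral>\<^sup>+x. g x \<partial>lborel) = ennreal \<bar>det A\<bar> * (\<integral>\<^sup>+x. g (A *v x) \<partial>lborel)"
proof -
  have "det A \<noteq> 0 \<longrightarrow> (\<forall>g \<in> borel_measurable borel.
     (\<integral>\<^sup>+x. g x \<partial>lborel) = ennreal \<bar>det A\<bar> * (\<integral>\<^sup>+x. g (A *v x) \<partial>lborel))"
  proof (induction A rule: induct_matrix_elementary)
    case (1 A B)
    show ?case
    proof (intro impI ballI)
      fix g :: "real^'n \<Rightarrow> ennreal"
      assume nz: "det (A ** B) \<noteq> 0" and g [measurable]: "g \<in> borel_measurable borel"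
      have gA: "(\<lambda>x. g (A *v x)) \<in> borel_measurable borel"
        by measurable
      have "(\<integral>\<^sup>+x. g x \<partial>lborel) = ennreal \<bar>det A\<bar> * (\<integral>\<^sup>+x. g (A *v x) \<partial>lborel)"
        using 1(1)[THEN mp, THEN bspec, OF _ g] nz by (simp add: det_mul)
      also have "(\<integral>\<^sup>+x. g (A *v x) \<partial>lborel) = ennreal \<bar>det B\<bar> * (\<integral>\<^sup>+x. g (A *v (B *v x)) \<partial>lborel)"
        using 1(2)[THEN mp, THEN bspec, OF _ gA] nz by (simp add: det_mul)
      finally show "(\<integral>\<^sup>+x. g x \<partial>lborel)
          = ennreal \<bar>det (A ** B)\<bar> * (\<integral>\<^sup>+x. g ((A ** B) *v x) \<partial>lborel)"
        by (simp add: det_mul abs_mult ennreal_mult mult.assoc matrix_vector_mul_assoc)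
    qed
  next
    case (2 A i)
    then show ?case
      by (simp add: det_zero_row)
  next
    case (3 A)
    show ?case
    proof (intro impI ballI)
      fix g :: "real^'n \<Rightarrow> ennreal"
      assume nz: "det A \<noteq> 0" and g [measurable]: "g \<in> borel_measurable borel"
      define c where "c b = (A *v b) \<bullet> b" for b
      have det: "det A = (\<Prod>i\<in>UNIV. A $ i $ i)"
        using 3 by (simp add: det_diagonal)
      have c: "c (axis i 1) = A $ i $ i" for i
        by (simp add: c_def inner_axis matrix_vector_mul_component)
      have nz': "c j \<noteq> 0" if "j \<in> Basis" for j
        using that nz det by (auto simp: Basis_vec_def c)
      have A: "(\<Sum>j\<in>Basis. (c j * (x \<bullet> j)) *\<^sub>R j) = A *v x" for x
      proof -
        have "(\<Sum>j\<in>UNIV. A $ i $ j * x $ j) = A $ i $ i * x $ i" for i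
          by (subst sum.remove[of _ i]) (auto simp: 3)
        moreover have "(\<Sum>j\<in>UNIV. A $ j $ j * x $ j * axis j 1 $ i) = A $ i $ i * x $ i" for i
          by (subst sum.remove[of _ i]) (auto simp: axis_def)
        ultimately show ?thesis
          by (simp add: sum_Basis_vec c inner_axis vec_eq_iff matrix_vector_mult_def)
      qed
      have eq: "lborel = density (distr lborel borel (\<lambda>x. A *v x)) (\<lambda>_. ennreal \<bar>det A\<bar>)"
        using lborel_affine_euclidean[of c 0, OF nz']
        by (simp add: A prod_Basis_vec c det abs_prod)
      have [measurable]: "(\<lambda>x. A *v x) \<in> borel \<rightarrow>\<^sub>M borel"
        by measurable
      show "(\<integral>\<^sup>+x. g x \<partial>lborel) = ennreal \<bar>det A\<bar> * (\<integral>\<^sup>+x. g (A *v x) \<partial>lborel)"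
        by (subst eq) (simp add: nn_integral_density nn_integral_distr nn_integral_cmult)
    qed
  next
    case (4 m n)
    show ?case
    proof (intro impI ballI)
      fix g :: "real^'n \<Rightarrow> ennreal"
      assume g [measurable]: "g \<in> borel_measurable borel"
      let ?p = "Transposition.transpose m n"
      let ?A = "(\<chi> i j. mat 1 $ i $ ?p j) :: real^'n^'n"
      have det1: "\<bar>det ?A\<bar> = 1"
        using det_permute_columns[of ?p "mat 1 :: real^'n^'n"]
        by (simp add: permutes_swap_id sign_swap_id 4)
      have A: "?A *v x = (\<chi> i. x $ ?p i)" for x
      proof -
        have "(\<Sum>j\<in>UNIV. mat 1 $ i $ ?p j * x $ j) = x $ ?p i" for i
          by (subst sum.remove[of _ "?p i"]) (auto simp: mat_def intro!: sum.neutral split: if_splits)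
        then show ?thesis
          by (simp add: vec_eq_iff matrix_vector_mult_def)
      qed
      have [measurable]: "(\<lambda>x. \<chi> i. x $ ?p i) \<in> (borel :: (real^'n) measure) \<rightarrow>\<^sub>M borel"
        by measurable
      have "lborel = distr lborel borel (\<lambda>x :: real^'n. \<chi> i. x $ ?p i)"
      proof (rule lborel_eqI)
        fix l u :: "real^'n" assume le: "\<And>b. b \<in> Basis \<Longrightarrow> l \<bullet> b \<le> u \<bullet> b"
        have le': "l $ i \<le> u $ i" for i
          using le[of "axis i 1"] by (simp add: inner_axis axis_in_Basis_iff)
        have le_p: "(\<chi> i. l $ ?p i) \<bullet> b \<le> (\<chi> i. u $ ?p i) \<bullet> b" if "b \<in> Basis" for b
          using that le' by (auto simp: Basis_vec_def inner_axis)
        have all_p: "(\<forall>i. Q i) \<longleftrightarrow> (\<forall>i. Q (?p i))" for Q :: "'n \<Rightarrow> bool"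
          by (metis transpose_involutory)
        have "x \<in> (\<lambda>x :: real^'n. \<chi> i. x $ ?p i) -` box l u
            \<longleftrightarrow> x \<in> box (\<chi> i. l $ ?p i) (\<chi> i. u $ ?p i)" for x
          unfolding mem_box_cart vimage_eq vec_lambda_beta
          by (subst all_p) simp
        then have "(\<lambda>x :: real^'n. \<chi> i. x $ ?p i) -` box l u
            = box (\<chi> i. l $ ?p i) (\<chi> i. u $ ?p i)"
          by blast
        moreover have "(\<Prod>i\<in>UNIV. u $ ?p i - l $ ?p i) = (\<Prod>i\<in>UNIV. u $ i - l $ i)"
          using prod.permute[of ?p UNIV "\<lambda>i. u $ i - l $ i"]
          by (simp add: permutes_swap_id o_def)
        ultimately show "emeasure (distr lborel borel (\<lambda>x :: real^'n. \<chi> i. x $ ?p i)) (box l u)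
            = (\<Prod>b\<in>Basis. (u - l) \<bullet> b)"
          by (simp add: emeasure_distr emeasure_lborel_box[OF le_p])
            (simp add: prod_Basis_vec inner_axis)
      qed simp
      then have "(\<integral>\<^sup>+x. g x \<partial>lborel)
          = (\<integral>\<^sup>+x. g x \<partial>distr lborel borel (\<lambda>x :: real^'n. \<chi> i. x $ ?p i))"
        by (rule arg_cong)
      also have "\<dots> = (\<integral>\<^sup>+x. g (\<chi> i. x $ ?p i) \<partial>lborel)"
        by (simp add: nn_integral_distr)
      finally show "(\<integral>\<^sup>+x. g x \<partial>lborel) = ennreal \<bar>det ?A\<bar> * (\<integral>\<^sup>+x. g (?A *v x) \<partial>lborel)"
        by (simp only: det1 A) simp
    qed
  next
    case (5 m n c)
    show ?case
    proof (intro impI ballI)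
      fix g :: "real^'n \<Rightarrow> ennreal"
      assume g [measurable]: "g \<in> borel_measurable borel"
      interpret product_sigma_finite "\<lambda>i::'n. lborel :: real measure"
        by standard
      let ?A = "(\<chi> i j. if i = m \<and> j = n then c else of_bool (i = j)) :: real^'n^'n"
      have "?A = (\<chi> k. if k = m then row m (mat 1) + c *s row n (mat 1) else row k (mat 1))"
        using 5 by (auto simp: vec_eq_iff row_def mat_def)
      then have det1: "det ?A = 1"
        using det_row_operation[OF 5, of "mat 1" c] by simp
      have A: "?A *v x = (\<chi> i. if i = m then c * x $ n + x $ m else x $ i)" for x
      proof -
        have "(\<Sum>j\<in>UNIV. of_bool (i = j) * x $ j) = x $ i" for i
          by (subst sum.remove[of _ i]) auto
        moreover have "(\<Sum>j\<in>UNIV. (if j = n then c else of_bool (m = j)) * x $ j) = c * x $ n + x $ m"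
          using 5 by (subst sum.remove[of _ n], simp, simp, subst sum.remove[of _ m]) auto
        ultimately show ?thesis
          by (simp add: vec_eq_iff matrix_vector_mult_def)
      qed
      (* Splitting off the coordinate m, in which the shear acts by translation. *)
      define I where "I = UNIV - {m}"
      have I: "insert m I = UNIV" "m \<notin> I" "finite I"
        by (auto simp: I_def)
      have split: "(\<integral>\<^sup>+x. h x \<partial>lborel)
        = (\<integral>\<^sup>+z. (\<integral>\<^sup>+y. h (\<chi> i. (z(m := y)) i) \<partial>lborel) \<partial>(\<Pi>\<^sub>M i\<in>I. lborel))"
        if [measurable]: "h \<in> borel_measurable borel" for h :: "real^'n \<Rightarrow> ennreal"
      proof -
        have "(\<lambda>z. h (\<chi> i. z i)) \<in> borel_measurable (\<Pi>\<^sub>M i\<in>insert m I. lborel)"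
          unfolding I by measurable
        from product_nn_integral_insert[OF I(3,2) this] show ?thesis
          unfolding I by (simp add: nn_integral_lborel_vec)
      qed
      have "(\<integral>\<^sup>+x. g x \<partial>lborel)
        = (\<integral>\<^sup>+z. (\<integral>\<^sup>+y. g (\<chi> i. (z(m := y)) i) \<partial>lborel) \<partial>(\<Pi>\<^sub>M i\<in>I. lborel))"
        by (simp add: split)
      also have "\<dots> = (\<integral>\<^sup>+z. (\<integral>\<^sup>+y. g (\<chi> i. (z(m := c * z n + y)) i) \<partial>lborel) \<partial>(\<Pi>\<^sub>M i\<in>I. lborel))"
      proof (rule nn_integral_cong)
        fix z :: "'n \<Rightarrow> real"
        have "(\<lambda>y. g (\<chi> i. (z(m := y)) i)) \<in> borel_measurable borel"
        proof (rule measurable_compose[OF _ g], rule measurable_vec_lambda)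
          fix i show "(\<lambda>y. (z(m := y)) i) \<in> borel_measurable borel"
            by (cases "i = m") auto
        qed
        from nn_integral_real_affine[OF this, of 1 "c * z n"]
        show "(\<integral>\<^sup>+y. g (\<chi> i. (z(m := y)) i) \<partial>lborel)
            = (\<integral>\<^sup>+y. g (\<chi> i. (z(m := c * z n + y)) i) \<partial>lborel)"
          by simp
      qed
      also have "\<dots> = (\<integral>\<^sup>+z. (\<integral>\<^sup>+y. g (?A *v (\<chi> i. (z(m := y)) i)) \<partial>lborel) \<partial>(\<Pi>\<^sub>M i\<in>I. lborel))"
        using 5 unfolding A
        by (intro nn_integral_cong arg_cong[of _ _ g]) (auto simp: vec_eq_iff)
      also have "\<dots> = (\<integral>\<^sup>+x. g (?A *v x) \<partial>lborel)"
      proof (rule split[symmetric])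
        show "(\<lambda>x. g (?A *v x)) \<in> borel_measurable borel"
          by measurable
      qed
      finally show "(\<integral>\<^sup>+x. g x \<partial>lborel) = ennreal \<bar>det ?A\<bar> * (\<integral>\<^sup>+x. g (?A *v x) \<partial>lborel)"
        by (simp add: det1)
    qed
  qed
  with assms show ?thesis by blast
qed

lemma nn_integral_lborel_affine:
  fixes A :: "real^'n^'n" and g :: "real^'n \<Rightarrow> ennreal"
  assumes "det A \<noteq> 0" and [measurable]: "g \<in> borel_measurable borel"
  shows "(\<integral>\<^sup>+x. g x \<partial>lborel) = ennreal \<bar>det A\<bar> * (\<integral>\<^sup>+y. g (a + A *v y) \<partial>lborel)"
proof -
  have "(\<integral>\<^sup>+x. g x \<partial>lborel) = (\<integral>\<^sup>+x. g x \<partial>distr lborel borel ((+) a))"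
    by (simp add: lborel_distr_plus)
  also have "\<dots> = (\<integral>\<^sup>+x. g (a + x) \<partial>lborel)"
    by (simp add: nn_integral_distr)
  also have "\<dots> = ennreal \<bar>det A\<bar> * (\<integral>\<^sup>+y. g (a + A *v y) \<partial>lborel)"
    using assms by (intro nn_integral_lborel_linear) auto
  finally show ?thesis .
qed

text \<open>The joint law of independent variables is the product of their laws, and a product of densities
  is a density of the product.\<close>

lemma (in prob_space) nn_integral_indep_densities:
  fixes X :: "'n::finite \<Rightarrow> 'a \<Rightarrow> real" and g :: "real^'n \<Rightarrow> ennreal"
  assumes indep: "indep_vars (\<lambda>i. borel) X UNIV"
    and X: "\<And>i. distributed M lborel (X i) (f i)"
    and g [measurable]: "g \<in> borel_measurable borel"
  shows "(\<integral>\<^sup>+\<omega>. g (\<chi> i. X i \<omega>) \<partial>M) = (\<integral>\<^sup>+y. (\<Prod>i\<in>UNIV. f i (y $ i)) * g y \<partial>lborel)"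
proof -
  interpret L: product_sigma_finite "\<lambda>i::'n. lborel :: real measure"
    by standard
  have f [measurable]: "f i \<in> borel_measurable borel" for i
    using distributed_borel_measurable[OF X[of i]] by simp
  have rv [measurable]: "X i \<in> borel_measurable M" for i
    using distributed_measurable[OF X[of i]] by simp
  have law: "distr M borel (X i) = density lborel (f i)" for i
    using distributed_distr_eq_density[OF X[of i]] by (simp cong: distr_cong)
  interpret F: product_prob_space "\<lambda>i. density lborel (f i)" UNIV
    by (intro product_prob_spaceI) (auto simp: law[symmetric] intro!: prob_space_distr)
  have "distr M (\<Pi>\<^sub>M i\<in>UNIV. borel) (\<lambda>\<omega> i. X i \<omega>) = (\<Pi>\<^sub>M i\<in>UNIV. density lborel (f i))"
    using indep by (subst (asm) indep_vars_iff_distr_eq_PiM) (auto simp: law restrict_def)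
  also have "\<dots> = density (\<Pi>\<^sub>M i\<in>UNIV. lborel) (\<lambda>z. \<Prod>i\<in>UNIV. f i (z i))"
  proof (rule F.PiM_eqI[symmetric])
    fix S :: "'n \<Rightarrow> real set" assume "\<And>i. i \<in> UNIV \<Longrightarrow> S i \<in> sets (density lborel (f i))"
    then have [measurable]: "S i \<in> sets borel" for i by simp
    have "emeasure (density (\<Pi>\<^sub>M i\<in>UNIV. lborel) (\<lambda>z. \<Prod>i\<in>UNIV. f i (z i))) (Pi\<^sub>E UNIV S)
      = (\<integral>\<^sup>+z. (\<Prod>i\<in>UNIV. f i (z i)) * indicator (Pi\<^sub>E UNIV S) z \<partial>(\<Pi>\<^sub>M i\<in>UNIV. lborel))"
      by (subst emeasure_density) (auto intro!: sets_PiM_I_finite)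
    also have "\<dots> = (\<integral>\<^sup>+z. (\<Prod>i\<in>UNIV. f i (z i) * indicator (S i) (z i)) \<partial>(\<Pi>\<^sub>M i\<in>UNIV. lborel))"
      by (intro nn_integral_cong) (auto simp: prod.distrib PiE_iff indicator_def)
    also have "\<dots> = (\<Prod>i\<in>UNIV. \<integral>\<^sup>+y. f i y * indicator (S i) y \<partial>lborel)"
      by (rule L.product_nn_integral_prod) auto
    also have "\<dots> = (\<Prod>i\<in>UNIV. emeasure (density lborel (f i)) (S i))"
      by (simp add: emeasure_density)
    finally show "emeasure (density (\<Pi>\<^sub>M i\<in>UNIV. lborel) (\<lambda>z. \<Prod>i\<in>UNIV. f i (z i))) (Pi\<^sub>E UNIV S)
      = (\<Prod>i\<in>UNIV. emeasure (density lborel (f i)) (S i))" .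
  qed (auto intro!: sets_PiM_cong)
  finally have eq: "distr M (\<Pi>\<^sub>M i\<in>UNIV. borel) (\<lambda>\<omega> i. X i \<omega>)
    = density (\<Pi>\<^sub>M i\<in>UNIV. lborel) (\<lambda>z. \<Prod>i\<in>UNIV. f i (z i))" .
  have "(\<integral>\<^sup>+\<omega>. g (\<chi> i. X i \<omega>) \<partial>M)
    = (\<integral>\<^sup>+z. g (\<chi> i. z i) \<partial>distr M (\<Pi>\<^sub>M i\<in>UNIV. borel) (\<lambda>\<omega> i. X i \<omega>))"
    by (subst nn_integral_distr) (auto intro!: measurable_PiM_single')
  also have "\<dots> = (\<integral>\<^sup>+z. (\<Prod>i\<in>UNIV. f i (z i)) * g (\<chi> i. z i) \<partial>(\<Pi>\<^sub>M i\<in>UNIV. lborel))"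
    unfolding eq by (subst nn_integral_density) auto
  also have "\<dots> = (\<integral>\<^sup>+y. (\<Prod>i\<in>UNIV. f i (y $ i)) * g y \<partial>lborel)"
    by (subst nn_integral_lborel_vec) auto
  finally show ?thesis .
qed

section \<open>Counts and allocations\<close>

text \<open>For an arbitrary sequence \<open>S\<close> the supremum takes the value \<open>0\<close> on the empty set, hence the
  special case \<open>j = 0\<close>. As no regularity of \<open>S\<close> enters, this description gives the measurability of the
  counts on the whole sample space.\<close>

lemma enat_le_counting_iff:
  "enat j \<le> counting S s \<omega> \<longleftrightarrow> j = 0 \<or> (\<exists>n\<ge>j. S n \<omega> \<le> s)"
proof (cases j)
  case (Suc i)
  have "enat i < counting S s \<omega> \<longleftrightarrow> (\<exists>n. S n \<omega> \<le> s \<and> i < n)"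
    by (auto simp: counting_def less_Sup_iff)
  then show ?thesis
    by (auto simp: Suc Suc_ile_eq Suc_le_eq)
qed (simp add: zero_enat_def[symmetric])

lemma counting_eq_enat_iff:
  "counting S s \<omega> = enat m \<longleftrightarrow> (m = 0 \<or> (\<exists>n\<ge>m. S n \<omega> \<le> s)) \<and> (\<forall>n>m. s < S n \<omega>)"
proof -
  have "counting S s \<omega> = enat m \<longleftrightarrow>
      enat m \<le> counting S s \<omega> \<and> \<not> enat (Suc m) \<le> counting S s \<omega>"
    by (auto simp: Suc_ile_eq)
  then show ?thesis
    by (auto simp: enat_le_counting_iff Suc_le_eq not_le)
qed

lemma counting_eq_enat_iff_mono:
  fixes S :: "nat \<Rightarrow> 'a \<Rightarrow> real"
  assumes "mono (\<lambda>n. S n \<omega>)" and "S 0 \<omega> \<le> s"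
  shows "counting S s \<omega> = enat m \<longleftrightarrow> S m \<omega> \<le> s \<and> s < S (Suc m) \<omega>"
proof -
  have "(m = 0 \<or> (\<exists>n\<ge>m. S n \<omega> \<le> s)) \<longleftrightarrow> S m \<omega> \<le> s"
    using assms(2) by (auto intro: order_trans[OF monoD[OF assms(1)]])
  moreover have "(\<forall>n>m. s < S n \<omega>) \<longleftrightarrow> s < S (Suc m) \<omega>"
    by (auto intro: less_le_trans[OF _ monoD[OF assms(1)]])
  ultimately show ?thesis
    by (simp add: counting_eq_enat_iff)
qed

lemma duration_sum_Suc: "duration_sum U h (Suc n) \<omega> = duration_sum U h n \<omega> + U h (Suc n) \<omega>"
  by (simp add: duration_sum_def)

lemma event_time_Suc: "event_time W (Suc n) \<omega> = event_time W n \<omega> + W (Suc n) \<omega>"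
  by (simp add: event_time_def)

lemma allocation_Suc:
  "allocation W V u (Suc n) \<omega> =
    allocation W V u n \<omega> + (if step_velocity W V n \<omega> = u then 1 else 0)"
proof -
  have "{j. j < Suc n \<and> step_velocity W V j \<omega> = u} =
      (if step_velocity W V n \<omega> = u then insert n else id) {j. j < n \<and> step_velocity W V j \<omega> = u}"
    by (auto simp: less_Suc_eq)
  then show ?thesis
    by (simp add: allocation_def)
qed

lemma displacements_eq_allocation:
  assumes "event_count W t \<omega> = enat m"
  shows "displacements W V u t \<omega> = allocation W V u (Suc m) \<omega>"
  using assms by (simp add: displacements_def allocation_def less_Suc_eq_le)

section \<open>The motion along a single trajectory\<close>

text \<open>The almost sure properties of the motion, gathered for a single outcome \<open>\<omega>\<close>. Everything that the
  proof needs about trajectories is deterministic and is derived from them.\<close>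

locale regular_path =
  fixes v :: "nat \<Rightarrow> real^'n"
    and W :: "nat \<Rightarrow> 'a \<Rightarrow> real"
    and V :: "real \<Rightarrow> 'a \<Rightarrow> real^'n"
    and U :: "nat \<Rightarrow> nat \<Rightarrow> 'a \<Rightarrow> real"
    and \<omega> :: 'a
  assumes v_inj: "inj_on v {..CARD('n)}"
    and W_nonneg: "0 \<le> W j \<omega>"
    and W_0: "W 0 \<omega> = 0"
    and V_values: "0 \<le> s \<Longrightarrow> V s \<omega> \<in> v ` {..CARD('n)}"
    and V_step: "0 \<le> s \<Longrightarrow> V s \<omega> = step_velocity W V (the_enat (event_count W s \<omega>)) \<omega>"
    and U_nonneg: "h \<le> CARD('n) \<Longrightarrow> 1 \<le> m \<Longrightarrow> 0 \<le> U h m \<omega>"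
    and U_duration: "h \<le> CARD('n) \<Longrightarrow> step_velocity W V j \<omega> = v h \<Longrightarrow>
      W (Suc j) \<omega> = U h (allocation W V (v h) (Suc j) \<omega>) \<omega>"
begin

lemma mono_event_time: "mono (\<lambda>n. event_time W n \<omega>)"
  by (intro incseq_SucI) (simp add: event_time_Suc W_nonneg)

lemma event_time_0: "event_time W 0 \<omega> = 0"
  by (simp add: event_time_def W_0)

lemma event_time_nonneg: "0 \<le> event_time W n \<omega>"
  using monoD[OF mono_event_time, of 0 n] by (simp add: event_time_0)

lemma event_count_eq_iff:
  "0 \<le> s \<Longrightarrow> event_count W s \<omega> = enat m \<longleftrightarrow>
    event_time W m \<omega> \<le> s \<and> s < event_time W (Suc m) \<omega>"
  unfolding event_count_def
  by (rule counting_eq_enat_iff_mono) (auto simp: mono_event_time event_time_0)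

lemma duration_count_eq_iff:
  assumes "h \<le> CARD('n)" and "0 \<le> s"
  shows "duration_count U h s \<omega> = enat m \<longleftrightarrow>
    duration_sum U h m \<omega> \<le> s \<and> s < duration_sum U h (Suc m) \<omega>"
  unfolding duration_count_def
proof (rule counting_eq_enat_iff_mono)
  show "mono (\<lambda>n. duration_sum U h n \<omega>)"
    by (intro incseq_SucI) (simp add: duration_sum_Suc U_nonneg assms)
qed (simp add: duration_sum_def assms)

lemma step_velocity_cases:
  obtains h where "h \<le> CARD('n)" "step_velocity W V j \<omega> = v h"
  using V_values[OF event_time_nonneg, of j] by (auto simp: step_velocity_def)

lemma step_velocity_eq_iff:
  "h \<le> CARD('n) \<Longrightarrow> h' \<le> CARD('n) \<Longrightarrow> step_velocity W V j \<omega> = v h' \<Longrightarrow>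
    step_velocity W V j \<omega> = v h \<longleftrightarrow> h = h'"
  using v_inj by (auto simp: inj_on_def)

lemma sum_allocation: "(\<Sum>h\<le>CARD('n). allocation W V (v h) N \<omega>) = N"
proof (induction N)
  case (Suc N)
  obtain k where k: "k \<le> CARD('n)" "step_velocity W V N \<omega> = v k"
    by (rule step_velocity_cases)
  have "(\<Sum>h\<le>CARD('n). allocation W V (v h) (Suc N) \<omega>) =
      (\<Sum>h\<le>CARD('n). allocation W V (v h) N \<omega> + (if h = k then 1 else 0))"
    by (intro sum.cong refl) (simp add: allocation_Suc step_velocity_eq_iff[OF _ k])
  then show ?case
    using Suc k(1) by (simp add: sum.distrib)
qed (simp add: allocation_def)

text \<open>Sorting the displacements by their velocity: the durations of those with velocity \<open>v h\<close> are
  \<open>U h 1, U h 2, \<dots>\<close> in the order of their selection, whatever the other velocities do in between. The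
  choice \<open>F = 1\<close> measures the elapsed time, and \<open>F = id\<close> the distance covered.\<close>

lemma sum_steps_by_velocity:
  fixes F :: "real^'n \<Rightarrow> 'b::real_vector"
  shows "(\<Sum>j<N. W (Suc j) \<omega> *\<^sub>R F (step_velocity W V j \<omega>)) =
    (\<Sum>h\<le>CARD('n). duration_sum U h (allocation W V (v h) N \<omega>) \<omega> *\<^sub>R F (v h))"
proof (induction N)
  case (Suc N)
  obtain k where k: "k \<le> CARD('n)" "step_velocity W V N \<omega> = v k"
    by (rule step_velocity_cases)
  have "(\<Sum>h\<le>CARD('n). duration_sum U h (allocation W V (v h) (Suc N) \<omega>) \<omega> *\<^sub>R F (v h)) =
      (\<Sum>h\<le>CARD('n). duration_sum U h (allocation W V (v h) N \<omega>) \<omega> *\<^sub>R F (v h)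
        + (if h = k then W (Suc N) \<omega> *\<^sub>R F (v k) else 0))"
  proof (intro sum.cong refl)
    fix h assume "h \<in> {..CARD('n)}"
    then have "step_velocity W V N \<omega> = v h \<longleftrightarrow> h = k"
      using step_velocity_eq_iff[OF _ k] by simp
    then show "duration_sum U h (allocation W V (v h) (Suc N) \<omega>) \<omega> *\<^sub>R F (v h) =
        duration_sum U h (allocation W V (v h) N \<omega>) \<omega> *\<^sub>R F (v h)
        + (if h = k then W (Suc N) \<omega> *\<^sub>R F (v k) else 0)"
      using U_duration[OF k]
      by (cases "h = k") (simp_all add: allocation_Suc duration_sum_Suc scaleR_add_left)
  qed
  then show ?case
    using Suc k by (simp add: sum.distrib)
qed (simp add: allocation_def duration_sum_def)

text \<open>The right end point is exceptional, since there the next step may have begun.\<close>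

lemma has_integral_within_step:
  assumes "event_time W m \<omega> \<le> s" and "s \<le> event_time W (Suc m) \<omega>"
  shows "((\<lambda>r. V r \<omega>) has_integral (s - event_time W m \<omega>) *\<^sub>R step_velocity W V m \<omega>)
    {event_time W m \<omega>..s}"
proof (rule has_integral_spike_finite[of "{s}"])
  show "((\<lambda>r. step_velocity W V m \<omega>) has_integral
      (s - event_time W m \<omega>) *\<^sub>R step_velocity W V m \<omega>) {event_time W m \<omega>..s}"
    using has_integral_const_real[of "step_velocity W V m \<omega>" "event_time W m \<omega>" s] assms
    by simp
  fix r assume "r \<in> {event_time W m \<omega>..s} - {s}"
  then have r: "event_time W m \<omega> \<le> r" "r < event_time W (Suc m) \<omega>" "0 \<le> r"
    using assms event_time_nonneg[of m] by auto
  then have "event_count W r \<omega> = enat m"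
    by (simp add: event_count_eq_iff)
  with V_step[OF r(3)] show "V r \<omega> = step_velocity W V m \<omega>"
    by simp
qed simp

lemma has_integral_up_to_event:
  "((\<lambda>r. V r \<omega>) has_integral (\<Sum>j<m. W (Suc j) \<omega> *\<^sub>R step_velocity W V j \<omega>))
    {0..event_time W m \<omega>}"
proof (induction m)
  case 0
  show ?case
    by (simp add: event_time_0 has_integral_refl)
next
  case (Suc m)
  have "event_time W m \<omega> \<le> event_time W (Suc m) \<omega>"
    by (simp add: event_time_Suc W_nonneg)
  from has_integral_combine[OF event_time_nonneg this Suc has_integral_within_step[OF this]]
  show ?case
    by (simp add: event_time_Suc)
qed

lemma position_eq:
  assumes "event_time W m \<omega> \<le> t" and "t \<le> event_time W (Suc m) \<omega>"
  shows "position V t \<omega> = (\<Sum>j<m. W (Suc j) \<omega> *\<^sub>R step_velocity W V j \<omega>)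
    + (t - event_time W m \<omega>) *\<^sub>R step_velocity W V m \<omega>"
  unfolding position_def
  by (intro integral_unique has_integral_combine[OF event_time_nonneg assms(1)]
    has_integral_up_to_event has_integral_within_step assms order.refl)

text \<open>From here on, the first \<open>m + 1\<close> displacements contain \<open>n h\<close> ones with velocity \<open>v h\<close> for each \<open>h\<close>, and
  the last of them has velocity \<open>v k\<close>. Then both ends of the current step are sums of durations taken
  separately for each velocity; the order in which the velocities were selected has disappeared.\<close>

context
  fixes n :: "nat \<Rightarrow> nat" and k m :: nat
  assumes k: "k \<le> CARD('n)"
    and n_pos: "1 \<le> n k"
    and alloc: "\<And>h. h \<le> CARD('n) \<Longrightarrow> allocation W V (v h) (Suc m) \<omega> = n h"
    and last: "step_velocity W V m \<omega> = v k"
begin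

lemma event_time_after_allocation:
  "event_time W (Suc m) \<omega> =
    (\<Sum>h\<in>{..CARD('n)} - {k}. duration_sum U h (n h) \<omega>) + duration_sum U k (n k) \<omega>"
proof -
  have "event_time W (Suc m) \<omega> = (\<Sum>j<Suc m. W (Suc j) \<omega> *\<^sub>R (1::real))"
    by (simp add: event_time_def W_0 lessThan_Suc_atMost sum.atMost_Suc_shift del: sum.atMost_Suc sum.lessThan_Suc)
  also have "\<dots> = (\<Sum>h\<le>CARD('n). duration_sum U h (n h) \<omega>)"
    unfolding sum_steps_by_velocity[where F = "\<lambda>_. 1"] by (simp add: alloc)
  also have "\<dots> = (\<Sum>h\<in>{..CARD('n)} - {k}. duration_sum U h (n h) \<omega>) + duration_sum U k (n k) \<omega>"
    using k by (subst sum.remove[of _ k]) auto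
  finally show ?thesis .
qed

text \<open>Of the displacements with velocity \<open>v k\<close>, exactly the current one is not complete yet.\<close>

lemma event_time_before_allocation:
  "event_time W m \<omega> =
    (\<Sum>h\<in>{..CARD('n)} - {k}. duration_sum U h (n h) \<omega>) + duration_sum U k (n k - 1) \<omega>"
proof -
  have "W (Suc m) \<omega> = U k (n k) \<omega>"
    using U_duration[OF k last] by (simp add: alloc k)
  moreover have "duration_sum U k (n k) \<omega> = duration_sum U k (n k - 1) \<omega> + U k (n k) \<omega>"
    using duration_sum_Suc[of U k "n k - 1"] n_pos by simp
  ultimately show ?thesis
    using event_time_after_allocation by (simp add: event_time_Suc)
qed

text \<open>The durations with velocity \<open>v k\<close> cancel: the time not spent with another velocity is spent with
  \<open>v k\<close>, including the current displacement.\<close>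

lemma position_after_allocation:
  assumes "event_time W m \<omega> \<le> t" and "t \<le> event_time W (Suc m) \<omega>"
  shows "position V t \<omega> = t *\<^sub>R v k +
    (\<Sum>h\<in>{..CARD('n)} - {k}. duration_sum U h (n h) \<omega> *\<^sub>R (v h - v k))"
proof -
  have "position V t \<omega> = (\<Sum>j<Suc m. W (Suc j) \<omega> *\<^sub>R step_velocity W V j \<omega>)
      + (t - event_time W (Suc m) \<omega>) *\<^sub>R v k"
    using position_eq[OF assms] by (simp add: last event_time_Suc algebra_simps)
  also have "(\<Sum>j<Suc m. W (Suc j) \<omega> *\<^sub>R step_velocity W V j \<omega>) =
      (\<Sum>h\<le>CARD('n). duration_sum U h (n h) \<omega> *\<^sub>R v h)"
    unfolding sum_steps_by_velocity[where F = "\<lambda>x. x"] by (simp add: alloc)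
  also have "\<dots> = (\<Sum>h\<in>{..CARD('n)} - {k}. duration_sum U h (n h) \<omega> *\<^sub>R v h)
      + duration_sum U k (n k) \<omega> *\<^sub>R v k"
    using k by (subst sum.remove[of _ k]) auto
  finally show ?thesis
    by (simp add: event_time_after_allocation algebra_simps sum_subtractf scaleR_sum_left)
qed

end

text \<open>The counts \<open>N\<^sub>h(t) = n\<^sub>h\<close> add up to \<open>N(t) + 1\<close>, so they fix the index of the current step. What
  remains splits into a condition on the selected velocities and one on the durations.\<close>

lemma motion_event_iff:
  assumes k: "k \<le> CARD('n)"
    and t: "0 \<le> t"
    and fin: "event_count W t \<omega> < \<infinity>"
    and n_pos: "1 \<le> n k"
  shows "(position V t \<omega> \<in> B \<and> (\<forall>h\<le>CARD('n). displacements W V (v h) t \<omega> = n h) \<and> V t \<omega> = v k)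
    \<longleftrightarrow> (\<forall>h\<le>CARD('n). allocation W V (v h) (\<Sum>i\<le>CARD('n). n i) \<omega> = n h)
      \<and> step_velocity W V ((\<Sum>i\<le>CARD('n). n i) - 1) \<omega> = v k
      \<and> t *\<^sub>R v k + (\<Sum>h\<in>{..CARD('n)} - {k}. duration_sum U h (n h) \<omega> *\<^sub>R (v h - v k)) \<in> B
      \<and> duration_sum U k (n k - 1) \<omega> \<le> t - (\<Sum>h\<in>{..CARD('n)} - {k}. duration_sum U h (n h) \<omega>)
      \<and> t - (\<Sum>h\<in>{..CARD('n)} - {k}. duration_sum U h (n h) \<omega>) < duration_sum U k (n k) \<omega>"
    (is "?lhs \<longleftrightarrow> ?alloc \<and> ?last \<and> ?pos \<and> ?before \<and> ?after")
proof
  assume ?lhs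
  then have pos: "position V t \<omega> \<in> B" and Vt: "V t \<omega> = v k"
    and disp: "\<And>h. h \<le> CARD('n) \<Longrightarrow> displacements W V (v h) t \<omega> = n h"
    by auto
  obtain m where m: "event_count W t \<omega> = enat m"
    using fin by (cases "event_count W t \<omega>") auto
  then have tm: "event_time W m \<omega> \<le> t" "t < event_time W (Suc m) \<omega>"
    using event_count_eq_iff[OF t] by auto
  have alloc: "\<And>h. h \<le> CARD('n) \<Longrightarrow> allocation W V (v h) (Suc m) \<omega> = n h"
    using disp by (simp add: displacements_eq_allocation[OF m])
  have last: "step_velocity W V m \<omega> = v k"
    using V_step[OF t] by (simp add: m Vt)
  have N: "(\<Sum>i\<le>CARD('n). n i) = Suc m"
    using sum_allocation[of "Suc m"] by (simp add: alloc)
  show "?alloc \<and> ?last \<and> ?pos \<and> ?before \<and> ?after"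
    using tm pos alloc last position_after_allocation[OF k n_pos alloc last tm(1) less_imp_le[OF tm(2)]]
    by (simp add: N event_time_after_allocation[OF k n_pos alloc last]
      event_time_before_allocation[OF k n_pos alloc last])
next
  assume rhs: "?alloc \<and> ?last \<and> ?pos \<and> ?before \<and> ?after"
  define m where "m = (\<Sum>i\<le>CARD('n). n i) - 1"
  have "n k \<le> (\<Sum>i\<le>CARD('n). n i)"
    using k by (intro member_le_sum) auto
  with n_pos have N: "(\<Sum>i\<le>CARD('n). n i) = Suc m"
    by (simp add: m_def)
  have alloc: "\<And>h. h \<le> CARD('n) \<Longrightarrow> allocation W V (v h) (Suc m) \<omega> = n h"
    and last: "step_velocity W V m \<omega> = v k"
    using rhs unfolding N by auto
  have tm: "event_time W m \<omega> \<le> t" "t < event_time W (Suc m) \<omega>"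
    using rhs by (simp_all add: event_time_after_allocation[OF k n_pos alloc last]
      event_time_before_allocation[OF k n_pos alloc last])
  then have m: "event_count W t \<omega> = enat m"
    using event_count_eq_iff[OF t] by auto
  show ?lhs
    using rhs alloc last V_step[OF t]
      position_after_allocation[OF k n_pos alloc last tm(1) less_imp_le[OF tm(2)]]
    by (auto simp: displacements_eq_allocation[OF m] m)
qed

end

section \<open>Coordinates relative to the velocities\<close>

lemma velocity_matrix_mult:
  "velocity_matrix v k e *v y = (\<Sum>i\<in>UNIV. y $ i *\<^sub>R (v (e i) - v k))"
  by (simp add: matrix_mult_sum velocity_matrix_def column_def vec_eq_iff)

text \<open>A vanishing combination of the columns \<open>v h - v k\<close> is an affine dependence of the velocities: give
  \<open>v k\<close> the coefficient that makes the sum of all coefficients zero.\<close>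

lemma det_velocity_matrix_nonzero:
  fixes v :: "nat \<Rightarrow> real^'n" and e :: "'n \<Rightarrow> nat"
  assumes inj: "inj_on v {..CARD('n)}"
    and indep: "\<not> affine_dependent (v ` {..CARD('n)})"
    and k: "k \<le> CARD('n)"
    and e: "bij_betw e UNIV ({..CARD('n)} - {k})"
  shows "det (velocity_matrix v k e) \<noteq> 0"
proof -
  have "y = 0" if y: "velocity_matrix v k e *v y = 0" for y
  proof (rule ccontr)
    assume "y \<noteq> 0"
    then obtain i where i: "y $ i \<noteq> 0"
      by (auto simp: vec_eq_iff)
    define a where "a h = (if h = k then - (\<Sum>j\<in>UNIV. y $ j) else y $ inv_into UNIV e h)" for h
    define c where "c u = a (inv_into {..CARD('n)} v u)" for u
    have inj_e: "inj e" and e_ne: "e j \<noteq> k" and e_le: "e j \<le> CARD('n)" for j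
      using e by (auto simp: bij_betw_def)
    have a_e: "a (e j) = y $ j" for j
      using e_ne[of j] inj_e by (simp add: a_def)
    have c_v: "c (v h) = a h" if "h \<le> CARD('n)" for h
      using that inj by (simp add: c_def)
    have sum_split: "(\<Sum>u\<in>v ` {..CARD('n)}. F u) = F (v k) + (\<Sum>j\<in>UNIV. F (v (e j)))"
      for F :: "real^'n \<Rightarrow> 'b::comm_monoid_add"
    proof -
      have "(\<Sum>u\<in>v ` {..CARD('n)}. F u) = (\<Sum>h\<le>CARD('n). F (v h))"
        by (simp add: sum.reindex[OF inj])
      also have "\<dots> = F (v k) + (\<Sum>h\<in>{..CARD('n)} - {k}. F (v h))"
        using k by (subst sum.remove[of _ k]) auto
      finally show ?thesis
        by (simp add: sum.reindex_bij_betw[OF e, of "\<lambda>h. F (v h)"])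
    qed
    have "sum c (v ` {..CARD('n)}) = 0"
      by (simp add: sum_split c_v k e_le a_e) (simp add: a_def)
    moreover have "(\<Sum>u\<in>v ` {..CARD('n)}. c u *\<^sub>R u) = 0"
      using y by (simp add: sum_split c_v k e_le a_e velocity_matrix_mult algebra_simps sum_subtractf)
        (simp add: a_def scaleR_sum_left)
    moreover have "c (v (e i)) \<noteq> 0" "v (e i) \<in> v ` {..CARD('n)}"
      using i e_le by (auto simp: c_v a_e)
    ultimately show False
      using indep by (subst (asm) affine_dependent_explicit_finite) auto
  qed
  then show ?thesis
    by (simp add: matrix_left_invertible_ker invertible_left_inverse flip: invertible_det_nz)
qed

lemma g_inv_velocity_matrix:
  fixes v :: "nat \<Rightarrow> real^'n"
  assumes "inj e" and "det (velocity_matrix v k e) \<noteq> 0"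
  shows "g_inv v k e t (e i) (t *\<^sub>R v k + velocity_matrix v k e *v y) = y $ i"
proof -
  let ?A = "velocity_matrix v k e"
  have "\<exists>A'. ?A ** A' = mat 1 \<and> A' ** ?A = mat 1"
    using assms(2) by (simp add: invertible_def flip: invertible_det_nz)
  then have "matrix_inv ?A ** ?A = mat 1"
    unfolding matrix_inv_def by (metis (mono_tags, lifting) someI_ex)
  then show ?thesis
    using assms(1) by (simp add: g_inv_def matrix_vector_mul_assoc)
qed

text \<open>The coordinates of a reachable point leave a nonnegative time for the velocity \<open>v k\<close>. This is
  where the hypothesis on the location of the point enters: at a negative time a count would be \<open>0\<close> by
  convention, although no displacement can be in progress then.\<close>

lemma convex_hull_coordinates:
  fixes v :: "nat \<Rightarrow> real^'n"
  assumes e: "bij_betw e UNIV ({..CARD('n)} - {k})" and "0 \<le> t"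
    and x: "x \<in> convex hull ((\<lambda>h. t *\<^sub>R v h) ` {..CARD('n)})"
  obtains y where "x = t *\<^sub>R v k + velocity_matrix v k e *v y" and "(\<Sum>i\<in>UNIV. y $ i) \<le> t"
proof -
  let ?G = "\<lambda>y. t *\<^sub>R v k + velocity_matrix v k e *v y"
  let ?H = "{y :: real^'n. (\<Sum>i\<in>UNIV. y $ i) \<le> t}"
  have "{y :: real^'n. (\<Sum>i\<in>UNIV. y $ i) \<le> t} = {y. (\<chi> i. 1) \<bullet> y \<le> t}"
    by (simp add: inner_vec_def)
  then have "convex ?H"
    by (simp add: convex_halfspace_le)
  then have "convex ((\<lambda>z. t *\<^sub>R v k + z) ` ((\<lambda>y. velocity_matrix v k e *v y) ` ?H))"
    by (intro convex_translation convex_linear_image matrix_vector_mul_linear)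
  then have "convex (?G ` ?H)"
    by (simp add: image_image)
  moreover have "t *\<^sub>R v h \<in> ?G ` ?H" if "h \<le> CARD('n)" for h
  proof (cases "h = k")
    case True
    then show ?thesis
      using \<open>0 \<le> t\<close> by (intro image_eqI[of _ _ 0]) auto
  next
    case False
    with that e obtain i where i: "h = e i"
      by (auto simp: bij_betw_def)
    have "(\<Sum>j\<in>UNIV. axis i t $ j *\<^sub>R (v (e j) - v k)) = t *\<^sub>R (v (e i) - v k)"
      by (subst sum.remove[of _ i]) (auto simp: axis_def)
    moreover have "(\<Sum>j\<in>UNIV. axis i t $ j) = t"
      by (subst sum.remove[of _ i]) (auto simp: axis_def)
    ultimately show ?thesis
      by (intro image_eqI[of _ _ "axis i t"]) (simp_all add: i velocity_matrix_mult algebra_simps)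
  qed
  ultimately have "convex hull ((\<lambda>h. t *\<^sub>R v h) ` {..CARD('n)}) \<subseteq> ?G ` ?H"
    by (intro hull_minimal) auto
  with x that show thesis
    by auto
qed

section \<open>Integrals and probabilities under independence\<close>

lemma (in prob_space) nn_integral_indep_var:
  assumes indep: "indep_var S X T Y" and g [measurable]: "g \<in> borel_measurable (S \<Otimes>\<^sub>M T)"
  shows "(\<integral>\<^sup>+\<omega>. g (X \<omega>, Y \<omega>) \<partial>M) = (\<integral>\<^sup>+\<omega>. \<integral>\<^sup>+\<omega>'. g (X \<omega>, Y \<omega>') \<partial>M \<partial>M)"
proof -
  have [measurable]: "X \<in> measurable M S" "Y \<in> measurable M T"
    and eq: "distr M (S \<Otimes>\<^sub>M T) (\<lambda>\<omega>. (X \<omega>, Y \<omega>)) = distr M S X \<Otimes>\<^sub>M distr M T Y"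
    using indep by (auto simp: indep_var_distribution_eq)
  interpret Y: prob_space "distr M T Y"
    by (rule prob_space_distr) simp
  have "(\<integral>\<^sup>+\<omega>. g (X \<omega>, Y \<omega>) \<partial>M) = (\<integral>\<^sup>+z. g z \<partial>(distr M S X \<Otimes>\<^sub>M distr M T Y))"
    by (simp add: nn_integral_distr flip: eq)
  also have "\<dots> = (\<integral>\<^sup>+x. \<integral>\<^sup>+y. g (x, y) \<partial>distr M T Y \<partial>distr M S X)"
    by (subst Y.nn_integral_fst[symmetric]) (simp_all cong: measurable_cong_sets)
  also have "\<dots> = (\<integral>\<^sup>+\<omega>. \<integral>\<^sup>+y. g (X \<omega>, y) \<partial>distr M T Y \<partial>M)"
    by (subst nn_integral_distr) simp_all
  also have "\<dots> = (\<integral>\<^sup>+\<omega>. \<integral>\<^sup>+\<omega>'. g (X \<omega>, Y \<omega>') \<partial>M \<partial>M)"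
    by (intro nn_integral_cong, subst nn_integral_distr)
      (auto intro: measurable_compose[OF _ g] dest: measurable_space[OF \<open>X \<in> measurable M S\<close>])
  finally show ?thesis .
qed

lemma (in prob_space) prob_indep_elements:
  assumes indep: "indep_elements M1 X M2 Y"
    and P: "Measurable.pred M1 P" and Q: "Measurable.pred M2 Q"
  shows "\<P>(\<omega> in M. P (X \<omega>) \<and> Q (Y \<omega>)) = \<P>(\<omega> in M. P (X \<omega>)) * \<P>(\<omega> in M. Q (Y \<omega>))"
proof -
  have X: "X \<in> measurable M M1" and Y: "Y \<in> measurable M M2"
    using indep by (auto simp: indep_elements_def)
  have PX: "{\<omega>\<in>space M. P (X \<omega>)} = X -` {x\<in>space M1. P x} \<inter> space M"
    using measurable_space[OF X] by auto
  have QY: "{\<omega>\<in>space M. Q (Y \<omega>)} = Y -` {y\<in>space M2. Q y} \<inter> space M"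
    using measurable_space[OF Y] by auto
  have "{x\<in>space M1. P x} \<in> sets M1" "{y\<in>space M2. Q y} \<in> sets M2"
    using P Q by (auto simp: pred_def)
  then have "{\<omega>\<in>space M. P (X \<omega>)} \<in> {X -` A \<inter> space M | A. A \<in> sets M1}"
    "{\<omega>\<in>space M. Q (Y \<omega>)} \<in> {Y -` A \<inter> space M | A. A \<in> sets M2}"
    unfolding PX QY by blast+
  from indep_setD[OF _ this] indep
  have "prob ({\<omega>\<in>space M. P (X \<omega>)} \<inter> {\<omega>\<in>space M. Q (Y \<omega>)})
      = \<P>(\<omega> in M. P (X \<omega>)) * \<P>(\<omega> in M. Q (Y \<omega>))"
    by (simp add: indep_elements_def)
  moreover have "{\<omega>\<in>space M. P (X \<omega>)} \<inter> {\<omega>\<in>space M. Q (Y \<omega>)}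
      = {\<omega>\<in>space M. P (X \<omega>) \<and> Q (Y \<omega>)}"
    by auto
  ultimately show ?thesis
    by simp
qed

lemma measurable_nested_component:
  assumes "h \<in> J" and "m \<in> L"
  shows "(\<lambda>z. z h m) \<in> borel_measurable (PiM J (\<lambda>h. \<Pi>\<^sub>M m\<in>L. borel))"
  by (rule measurable_compose[where f = "\<lambda>z. z h" and g = "\<lambda>u. u m"])
    (use assms in \<open>auto intro: measurable_component_singleton\<close>)

lemma (in prob_space) ennreal_prob_eq_nn_integral:
  assumes "Measurable.pred M P"
  shows "ennreal \<P>(\<omega> in M. P \<omega>) = (\<integral>\<^sup>+\<omega>. (if P \<omega> then 1 else 0) \<partial>M)"
proof -
  have "ennreal \<P>(\<omega> in M. P \<omega>) = (\<integral>\<^sup>+\<omega>. indicator {\<omega>\<in>space M. P \<omega>} \<omega> \<partial>M)"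
    using assms by (simp add: emeasure_eq_measure)
  also have "\<dots> = (\<integral>\<^sup>+\<omega>. (if P \<omega> then 1 else 0) \<partial>M)"
    by (intro nn_integral_cong) simp
  finally show ?thesis .
qed

lemma (in prob_space) measurable_prob_between:
  fixes a b :: "'a \<Rightarrow> real"
  assumes [measurable]: "a \<in> borel_measurable M" "b \<in> borel_measurable M"
  shows "(\<lambda>s. ennreal \<P>(\<omega> in M. a \<omega> \<le> s \<and> s < b \<omega>)) \<in> borel_measurable borel"
  by (subst ennreal_prob_eq_nn_integral) measurable

section \<open>The law of the position\<close>

context minimal_random_motion_independent
begin

lemma AE_regular_path: "AE \<omega> in M. regular_path v W V U \<omega>"
proof -
  have "AE \<omega> in M. \<forall>n. 0 \<le> W n \<omega>"
    using W_nonneg by (simp add: AE_all_countable)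
  moreover have "AE \<omega> in M. \<forall>h m. h \<le> CARD('n) \<longrightarrow> 1 \<le> m \<longrightarrow> 0 \<le> U h m \<omega>"
    using U_nonneg by (simp add: AE_all_countable)
  moreover have "AE \<omega> in M. \<forall>h\<in>{..CARD('n)}. \<forall>j m. step_velocity W V j \<omega> = v h
      \<and> allocation W V (v h) (Suc j) \<omega> = m \<longrightarrow> W (Suc j) \<omega> = U h m \<omega>"
    unfolding AE_all_countable[symmetric]
    by (intro AE_finite_allI AE_all_countable[THEN iffD2] allI U_duration) auto
  ultimately show ?thesis
    using W_0 V_values V_step
  proof eventually_elim
    case (elim \<omega>)
    then show ?case
      by unfold_locales (use v_inj in auto)
  qed
qed

lemma step_velocity_measurable [measurable]: "step_velocity W V j \<in> borel_measurable M"
proof -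
  have "(\<lambda>\<omega> j. step_velocity W V j \<omega>) \<in> measurable M (\<Pi>\<^sub>M j\<in>UNIV. borel)"
    using durations_indep_velocities by (simp add: indep_elements_def)
  then show ?thesis
    using measurable_component_singleton[of j UNIV "\<lambda>_. borel"]
    by (auto dest: measurable_compose[where g = "\<lambda>s. s j"])
qed

lemma event_time_measurable [measurable]: "event_time W j \<in> borel_measurable M"
  using W_measurable by (simp add: event_time_def[abs_def])

lemma U_measurable:
  assumes "h \<le> CARD('n)" and "1 \<le> m"
  shows "U h m \<in> borel_measurable M"
proof -
  have "(\<lambda>\<omega>. \<lambda>m\<in>{1..}. U h m \<omega>) \<in> measurable M (\<Pi>\<^sub>M m\<in>{1..}. borel)"
    using durations_indep assms by (simp add: indep_vars_def)
  from measurable_compose[OF this measurable_component_singleton[of m]] assms(2)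
  show ?thesis
    by simp
qed

lemma duration_sum_measurable:
  assumes "h \<le> CARD('n)"
  shows "duration_sum U h m \<in> borel_measurable M"
  unfolding duration_sum_def[abs_def] using U_measurable[OF assms] by (intro borel_measurable_sum) auto

text \<open>Infinitely many displacements up to time \<open>t\<close> may occur on a null set, where the cardinality is
  \<open>0\<close>; this does not affect measurability.\<close>

lemma displacements_measurable [measurable]:
  "displacements W V u t \<in> measurable M (count_space UNIV)"
  unfolding displacements_def[abs_def] event_count_def enat_le_counting_iff
  by measurable

lemma indep_duration_sums:
  assumes e: "inj e" "\<And>i. e i \<le> CARD('n)"
  shows "indep_vars (\<lambda>_. borel) (\<lambda>i :: 'i. duration_sum U (e i) (n i)) UNIV"
proof -
  let ?\<U> = "\<lambda>h \<omega>. \<lambda>m\<in>{1..}. U h m \<omega>"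
  have "indep_vars (\<lambda>i. PiM {e i} (\<lambda>h. \<Pi>\<^sub>M m\<in>{1..}. borel)) (\<lambda>i \<omega>. \<lambda>h\<in>{e i}. ?\<U> h \<omega>) UNIV"
    using e by (intro indep_vars_restrict[OF durations_indep])
      (auto simp: disjoint_family_on_def dest: injD)
  then have "indep_vars (\<lambda>_. borel) (\<lambda>i \<omega>. \<Sum>j=1..n i. (\<lambda>h\<in>{e i}. ?\<U> h \<omega>) (e i) j) UNIV"
    by (rule indep_vars_compose2[where Y = "\<lambda>i z. \<Sum>j=1..n i. z (e i) j"])
      (auto intro!: borel_measurable_sum measurable_nested_component)
  moreover have "(\<lambda>i \<omega>. \<Sum>j=1..n i. (\<lambda>h\<in>{e i}. ?\<U> h \<omega>) (e i) j) = (\<lambda>i. duration_sum U (e i) (n i))"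
    by (intro ext) (simp add: duration_sum_def)
  ultimately show ?thesis
    by (simp only:)
qed

text \<open>By the independence of the durations for different velocities, those with velocity \<open>v k\<close> may be
  drawn from a second, independent copy \<open>\<omega>'\<close> of the motion.\<close>

lemma nn_integral_separate_velocity:
  fixes e :: "'i::finite \<Rightarrow> nat" and g :: "real^'i \<Rightarrow> real \<Rightarrow> real \<Rightarrow> ennreal"
  assumes k: "k \<le> CARD('n)" and e: "range e \<subseteq> {..CARD('n)} - {k}"
    and g [measurable]: "(\<lambda>(y, a, b). g y a b) \<in> borel_measurable (borel \<Otimes>\<^sub>M borel \<Otimes>\<^sub>M borel)"
  shows "(\<integral>\<^sup>+\<omega>. g (\<chi> i. duration_sum U (e i) (n i) \<omega>) (duration_sum U k p \<omega>) (duration_sum U k q \<omega>) \<partial>M)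
    = (\<integral>\<^sup>+\<omega>. \<integral>\<^sup>+\<omega>'. g (\<chi> i. duration_sum U (e i) (n i) \<omega>)
        (duration_sum U k p \<omega>') (duration_sum U k q \<omega>') \<partial>M \<partial>M)"
proof -
  let ?\<U> = "\<lambda>h \<omega>. \<lambda>m\<in>{1..}. U h m \<omega>"
  let ?S = "\<lambda>J. PiM J (\<lambda>h. \<Pi>\<^sub>M m\<in>{1..}. (borel :: real measure))"
  let ?J = "{..CARD('n)} - {k}"
  define s where "s h m z = (\<Sum>j=1..m. z h j)" for h m and z :: "nat \<Rightarrow> nat \<Rightarrow> real"
  have s: "s h m \<in> borel_measurable (?S J)" if "h \<in> J" for h m J
    unfolding s_def[abs_def] using that
    by (intro borel_measurable_sum measurable_nested_component) auto
  have s_\<U>: "s h m (\<lambda>h\<in>J. ?\<U> h \<omega>) = duration_sum U h m \<omega>" if "h \<in> J" for h m J \<omega>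
    using that by (simp add: s_def duration_sum_def)
  have e': "e i \<in> ?J" for i
    using e by auto
  have [measurable]: "(\<lambda>z. \<chi> i. s (e i) (n i) z) \<in> borel_measurable (?S ?J)"
    using e' by (intro measurable_vec_lambda s) auto
  have [measurable]: "s k m \<in> borel_measurable (?S {k})" for m
    by (intro s) auto
  have ind: "indep_var (?S ?J) (\<lambda>\<omega>. \<lambda>h\<in>?J. ?\<U> h \<omega>) (?S {k}) (\<lambda>\<omega>. \<lambda>h\<in>{k}. ?\<U> h \<omega>)"
    using k by (intro indep_var_restrict[OF durations_indep]) auto
  have meas: "(\<lambda>(x, y). g (\<chi> i. s (e i) (n i) x) (s k p y) (s k q y))
      \<in> borel_measurable (?S ?J \<Otimes>\<^sub>M ?S {k})"
  proof -
    have "(\<lambda>z. (\<chi> i. s (e i) (n i) (fst z), s k p (snd z), s k q (snd z)))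
        \<in> (?S ?J \<Otimes>\<^sub>M ?S {k}) \<rightarrow>\<^sub>M (borel \<Otimes>\<^sub>M borel \<Otimes>\<^sub>M borel)"
      by measurable
    from measurable_compose[OF this g] show ?thesis
      by (simp add: split_beta')
  qed
  have s_k: "s k m (\<lambda>h\<in>{k}. ?\<U> h \<omega>) = duration_sum U k m \<omega>" for m \<omega>
    by (rule s_\<U>) simp
  show ?thesis
    using nn_integral_indep_var[OF ind meas] by (simp only: prod.case s_\<U>[OF e'] s_k)
qed

text \<open>For \<open>s < 0\<close> the count is \<open>0\<close> although no displacement is in progress, so for \<open>p = 0\<close> the identity
  needs a nonnegative time.\<close>

lemma prob_duration_count:
  assumes k: "k \<le> CARD('n)" and "0 \<le> s"
  shows "\<P>(\<omega> in M. duration_count U k s \<omega> = enat p)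
    = \<P>(\<omega> in M. duration_sum U k p \<omega> \<le> s \<and> s < duration_sum U k (Suc p) \<omega>)"
proof (rule prob_eq_AE)
  have [measurable]: "duration_sum U k m \<in> borel_measurable M" for m
    by (rule duration_sum_measurable[OF k])
  show "AE \<omega> in M. duration_count U k s \<omega> = enat p \<longleftrightarrow>
      duration_sum U k p \<omega> \<le> s \<and> s < duration_sum U k (Suc p) \<omega>"
    using AE_regular_path
  proof eventually_elim
    case (elim \<omega>)
    then interpret regular_path v W V U \<omega> .
    show ?case
      by (rule duration_count_eq_iff[OF assms])
  qed
  show "{\<omega>\<in>space M. duration_count U k s \<omega> = enat p} \<in> events"
    unfolding duration_count_def counting_eq_enat_iff by measurable
  show "{\<omega>\<in>space M. duration_sum U k p \<omega> \<le> s \<and> s < duration_sum U k (Suc p) \<omega>} \<in> events"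
    by measurable
qed

text \<open>The event of the theorem is, up to a null set, the intersection of an event that depends on the
  durations only and one that depends on the selected velocities only.\<close>

lemma prob_motion_event:
  fixes e :: "'n \<Rightarrow> nat"
  assumes t: "0 \<le> t" and k: "k \<le> CARD('n)" and n_pos: "1 \<le> n k"
    and e: "bij_betw e UNIV ({..CARD('n)} - {k})" and B [measurable]: "B \<in> sets borel"
  defines "Y \<equiv> \<lambda>\<omega>. \<chi> i. duration_sum U (e i) (n (e i)) \<omega>"
  shows "\<P>(\<omega> in M. position V t \<omega> \<in> B
        \<and> (\<forall>h\<le>CARD('n). displacements W V (v h) t \<omega> = n h) \<and> V t \<omega> = v k)
    = \<P>(\<omega> in M. t *\<^sub>R v k + velocity_matrix v k e *v Y \<omega> \<in> B
        \<and> duration_sum U k (n k - 1) \<omega> \<le> t - (\<Sum>i\<in>UNIV. Y \<omega> $ i)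
        \<and> t - (\<Sum>i\<in>UNIV. Y \<omega> $ i) < duration_sum U k (n k) \<omega>)
      * \<P>(\<omega> in M. (\<forall>h\<le>CARD('n). allocation W V (v h) (\<Sum>i\<le>CARD('n). n i) \<omega> = n h)
        \<and> step_velocity W V ((\<Sum>i\<le>CARD('n). n i) - 1) \<omega> = v k)"
proof -
  let ?G = "\<lambda>y. t *\<^sub>R v k + velocity_matrix v k e *v y"
  let ?N = "\<Sum>i\<le>CARD('n). n i"
  define a where "a = duration_sum U k (n k - 1)"
  define b where "b = duration_sum U k (n k)"
  define E1 where "E1 \<omega> \<longleftrightarrow> ?G (Y \<omega>) \<in> B
      \<and> a \<omega> \<le> t - (\<Sum>i\<in>UNIV. Y \<omega> $ i) \<and> t - (\<Sum>i\<in>UNIV. Y \<omega> $ i) < b \<omega>" for \<omega>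
  define E2 where "E2 \<omega> \<longleftrightarrow> (\<forall>h\<le>CARD('n). allocation W V (v h) ?N \<omega> = n h)
      \<and> step_velocity W V (?N - 1) \<omega> = v k" for \<omega>
  have e_le: "e i \<le> CARD('n)" for i
    using e by (auto simp: bij_betw_def)
  have reindex: "(\<Sum>h\<in>{..CARD('n)} - {k}. F h) = (\<Sum>i\<in>UNIV. F (e i))"
    for F :: "nat \<Rightarrow> 'b::comm_monoid_add"
    by (rule sum.reindex_bij_betw[OF e, symmetric])
  have [measurable]: "Y \<in> borel_measurable M" "a \<in> borel_measurable M" "b \<in> borel_measurable M"
    unfolding Y_def a_def b_def
    by (intro measurable_vec_lambda duration_sum_measurable e_le k)+

  have event: "\<P>(\<omega> in M. position V t \<omega> \<in> B
      \<and> (\<forall>h\<le>CARD('n). displacements W V (v h) t \<omega> = n h) \<and> V t \<omega> = v k)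
      = \<P>(\<omega> in M. E1 \<omega> \<and> E2 \<omega>)"
  proof (rule prob_eq_AE)
    show "AE \<omega> in M. (position V t \<omega> \<in> B \<and> (\<forall>h\<le>CARD('n). displacements W V (v h) t \<omega> = n h)
        \<and> V t \<omega> = v k) \<longleftrightarrow> E1 \<omega> \<and> E2 \<omega>"
      using AE_regular_path event_count_finite[OF t]
    proof eventually_elim
      case (elim \<omega>)
      then interpret regular_path v W V U \<omega>
        by simp
      show ?case
        using motion_event_iff[where n = n, OF k t elim(2) n_pos, of B]
        by (auto simp: E1_def E2_def Y_def a_def b_def reindex velocity_matrix_mult)
    qed
    have [measurable]: "position V t \<in> borel_measurable M" "V t \<in> borel_measurable M"
      using position_measurable V_measurable t by auto
    show "{\<omega>\<in>space M. position V t \<omega> \<in> B \<and> (\<forall>h\<le>CARD('n). displacements W V (v h) t \<omega> = n h)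
        \<and> V t \<omega> = v k} \<in> events"
      by measurable
    show "{\<omega>\<in>space M. E1 \<omega> \<and> E2 \<omega>} \<in> events"
      unfolding E1_def E2_def allocation_def by measurable
  qed

  have product: "\<P>(\<omega> in M. E1 \<omega> \<and> E2 \<omega>) = \<P>(\<omega> in M. E1 \<omega>) * \<P>(\<omega> in M. E2 \<omega>)"
  proof -
    let ?I = "{..CARD('n)} \<times> {1::nat..}"
    define M1 where "M1 = (\<Pi>\<^sub>M (h, m)\<in>?I. (borel :: real measure))"
    let ?M2 = "\<Pi>\<^sub>M j\<in>(UNIV :: nat set). (borel :: (real^'n) measure)"
    let ?X = "\<lambda>\<omega>. \<lambda>(h, m)\<in>?I. U h m \<omega>"
    (* Both events, as properties of the family of durations and of the sequence of velocities. *)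
    define s where "s h m d = (\<Sum>j=1..m. d (h, j))" for h m and d :: "nat \<times> nat \<Rightarrow> real"
    define P where "P d \<longleftrightarrow> ?G (\<chi> i. s (e i) (n (e i)) d) \<in> B
      \<and> s k (n k - 1) d \<le> t - (\<Sum>i\<in>UNIV. s (e i) (n (e i)) d)
      \<and> t - (\<Sum>i\<in>UNIV. s (e i) (n (e i)) d) < s k (n k) d" for d
    define Q where "Q u \<longleftrightarrow> (\<forall>h\<le>CARD('n). card {j. j < ?N \<and> u j = v h} = n h)
      \<and> u (?N - 1) = v k" for u :: "nat \<Rightarrow> real^'n"
    have s_meas: "s h m \<in> borel_measurable M1" if "h \<le> CARD('n)" for h m
    proof -
      have "(\<lambda>d. d (h, j)) \<in> borel_measurable M1" if "j \<in> {1..m}" for j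
        using measurable_component_singleton[of "(h, j)" ?I "\<lambda>(h, m). borel"] that \<open>h \<le> CARD('n)\<close>
        by (simp add: M1_def)
      then show ?thesis
        unfolding s_def[abs_def] by (intro borel_measurable_sum) auto
    qed
    have [measurable]: "s (e i) m \<in> borel_measurable M1" "s k m \<in> borel_measurable M1" for i m
      by (intro s_meas e_le k)+
    have [measurable]: "(\<lambda>d. t - (\<Sum>i\<in>UNIV. s (e i) (n (e i)) d)) \<in> borel_measurable M1"
      by (intro borel_measurable_diff borel_measurable_sum s_meas e_le) simp
    have [measurable]: "Measurable.pred M1 (\<lambda>d. s k m d \<le> t - (\<Sum>i\<in>UNIV. s (e i) (n (e i)) d))"
      "Measurable.pred M1 (\<lambda>d. t - (\<Sum>i\<in>UNIV. s (e i) (n (e i)) d) < s k m d)" for m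
      unfolding pred_def by (intro borel_measurable_le borel_measurable_less s_meas k; measurable)+
    have "Measurable.pred M1 P"
      unfolding P_def[abs_def] by measurable
    moreover have "Measurable.pred ?M2 Q"
      unfolding Q_def[abs_def] by measurable
    moreover have "P (?X \<omega>) \<longleftrightarrow> E1 \<omega>" for \<omega>
    proof -
      have "s h m (?X \<omega>) = duration_sum U h m \<omega>" if "h \<le> CARD('n)" for h m
        using that by (simp add: s_def duration_sum_def)
      then show ?thesis
        by (simp only: P_def E1_def Y_def a_def b_def e_le k vec_lambda_beta)
    qed
    moreover have "Q (\<lambda>j. step_velocity W V j \<omega>) \<longleftrightarrow> E2 \<omega>" for \<omega>
      by (simp only: Q_def E2_def allocation_def)
    ultimately show ?thesis
      using prob_indep_elements[OF durations_indep_velocities[folded M1_def], of P Q] by (simp only:)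
  qed

  show ?thesis
    unfolding event product by (simp only: E1_def E2_def a_def b_def)
qed

text \<open>Freezing \<open>Y\<close> while averaging over the durations with velocity \<open>v k\<close>, which are independent of it,
  turns the condition on the latter into a function of \<open>Y\<close>; this function is then integrated against
  the joint density of the components of \<open>Y\<close>.\<close>

lemma prob_durations_density:
  fixes e :: "'i::finite \<Rightarrow> nat" and f :: "'i \<Rightarrow> real \<Rightarrow> real"
  assumes k: "k \<le> CARD('n)" and e: "inj e" "range e \<subseteq> {..CARD('n)} - {k}"
    and f_nonneg: "\<And>i x. 0 \<le> f i x"
    and f: "\<And>i. distributed M lborel (duration_sum U (e i) (n i)) (\<lambda>x. ennreal (f i x))"
    and C [measurable]: "C \<in> sets borel"
  defines "Y \<equiv> \<lambda>\<omega>. \<chi> i. duration_sum U (e i) (n i) \<omega>"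
  shows "ennreal \<P>(\<omega> in M. Y \<omega> \<in> C
        \<and> duration_sum U k p \<omega> \<le> t - (\<Sum>i\<in>UNIV. Y \<omega> $ i)
        \<and> t - (\<Sum>i\<in>UNIV. Y \<omega> $ i) < duration_sum U k q \<omega>)
    = (\<integral>\<^sup>+y. ennreal (\<Prod>i\<in>UNIV. f i (y $ i)) * (indicator C y *
        ennreal \<P>(\<omega> in M. duration_sum U k p \<omega> \<le> t - (\<Sum>i\<in>UNIV. y $ i)
          \<and> t - (\<Sum>i\<in>UNIV. y $ i) < duration_sum U k q \<omega>)) \<partial>lborel)"
proof -
  define g where "g y a b = (if y \<in> C \<and> a \<le> t - (\<Sum>i\<in>UNIV. y $ i)
    \<and> t - (\<Sum>i\<in>UNIV. y $ i) < b then 1 else 0 :: ennreal)" for y :: "real^'i" and a b :: real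
  define a where "a = duration_sum U k p"
  define b where "b = duration_sum U k q"
  have e_le: "e i \<le> CARD('n)" for i
    using e(2) by auto
  have [measurable]: "Y \<in> borel_measurable M" "a \<in> borel_measurable M" "b \<in> borel_measurable M"
    unfolding Y_def a_def b_def
    by (intro measurable_vec_lambda duration_sum_measurable e_le k)+
  have [measurable]: "(\<lambda>s. ennreal \<P>(\<omega> in M. a \<omega> \<le> s \<and> s < b \<omega>)) \<in> borel_measurable borel"
    by (rule measurable_prob_between) measurable
  have [measurable]: "f i \<in> borel_measurable borel" for i
    using distributed_real_measurable[OF _ f] f_nonneg by simp
  have g [measurable]: "(\<lambda>(y, a, b). g y a b) \<in> borel_measurable (borel \<Otimes>\<^sub>M borel \<Otimes>\<^sub>M borel)"
    unfolding g_def by measurable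
  have "ennreal \<P>(\<omega> in M. Y \<omega> \<in> C \<and> a \<omega> \<le> t - (\<Sum>i\<in>UNIV. Y \<omega> $ i)
      \<and> t - (\<Sum>i\<in>UNIV. Y \<omega> $ i) < b \<omega>) = (\<integral>\<^sup>+\<omega>. g (Y \<omega>) (a \<omega>) (b \<omega>) \<partial>M)"
    unfolding g_def by (rule ennreal_prob_eq_nn_integral) measurable
  also have "\<dots> = (\<integral>\<^sup>+\<omega>. \<integral>\<^sup>+\<omega>'. g (Y \<omega>) (a \<omega>') (b \<omega>') \<partial>M \<partial>M)"
    unfolding Y_def a_def b_def by (rule nn_integral_separate_velocity[OF k e(2) g])
  also have "\<dots> = (\<integral>\<^sup>+\<omega>. indicator C (Y \<omega>) * ennreal \<P>(\<omega>' in M.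
      a \<omega>' \<le> t - (\<Sum>i\<in>UNIV. Y \<omega> $ i) \<and> t - (\<Sum>i\<in>UNIV. Y \<omega> $ i) < b \<omega>') \<partial>M)"
  proof (rule nn_integral_cong)
    fix \<omega>
    have "ennreal \<P>(\<omega>' in M. a \<omega>' \<le> s \<and> s < b \<omega>')
        = (\<integral>\<^sup>+\<omega>'. (if a \<omega>' \<le> s \<and> s < b \<omega>' then 1 else 0) \<partial>M)" for s
      by (rule ennreal_prob_eq_nn_integral) measurable
    then show "(\<integral>\<^sup>+\<omega>'. g (Y \<omega>) (a \<omega>') (b \<omega>') \<partial>M) = indicator C (Y \<omega>) * ennreal \<P>(\<omega>' in M.
        a \<omega>' \<le> t - (\<Sum>i\<in>UNIV. Y \<omega> $ i) \<and> t - (\<Sum>i\<in>UNIV. Y \<omega> $ i) < b \<omega>')"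
      by (simp add: g_def split: split_indicator)
  qed
  also have "\<dots> = (\<integral>\<^sup>+y. (\<Prod>i\<in>UNIV. ennreal (f i (y $ i))) * (indicator C y * ennreal \<P>(\<omega>' in M.
      a \<omega>' \<le> t - (\<Sum>i\<in>UNIV. y $ i) \<and> t - (\<Sum>i\<in>UNIV. y $ i) < b \<omega>')) \<partial>lborel)"
    unfolding Y_def
    by (rule nn_integral_indep_densities[OF indep_duration_sums[OF e(1) e_le] f]) measurable
  finally show ?thesis
    unfolding a_def b_def by (simp add: prod_ennreal f_nonneg)
qed

end

theorem theorem2p2:
  fixes M :: "'a measure"
    and v :: "nat \<Rightarrow> real^'n"
    and W :: "nat \<Rightarrow> 'a \<Rightarrow> real"
    and V :: "real \<Rightarrow> 'a \<Rightarrow> real^'n"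
    and U :: "nat \<Rightarrow> nat \<Rightarrow> 'a \<Rightarrow> real"
    and f :: "nat \<Rightarrow> nat \<Rightarrow> real \<Rightarrow> real"
    and t :: real
    and n :: "nat \<Rightarrow> nat"
    and k :: nat
    and e :: "'n \<Rightarrow> nat"
    and B :: "(real^'n) set"
  assumes motion: "minimal_random_motion_independent M v W V U"
    and density_nonneg: "\<And>h m y. h \<le> CARD('n) \<Longrightarrow> 1 \<le> m \<Longrightarrow> 0 \<le> f h m y"
    and density: "\<And>h m. h \<le> CARD('n) \<Longrightarrow> 1 \<le> m \<Longrightarrow>
      distributed M lborel (duration_sum U h m) (\<lambda>y. ennreal (f h m y))"
    and "0 \<le> t"
    and "\<And>h. h \<le> CARD('n) \<Longrightarrow> 1 \<le> n h"
    and "k \<le> CARD('n)"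
    and "bij_betw e UNIV ({..CARD('n)} - {k})"
    and "B \<in> sets borel"
    and "B \<subseteq> interior (convex hull ((\<lambda>h. t *\<^sub>R v h) ` {..CARD('n)}))"
  shows "ennreal (\<P>(\<omega> in M. position V t \<omega> \<in> B
              \<and> (\<forall>h\<le>CARD('n). displacements W V (v h) t \<omega> = n h) \<and> V t \<omega> = v k))
    = (\<integral>\<^sup>+x\<in>B. ennreal (
          (\<Prod>h\<in>{..CARD('n)} - {k}. f h (n h) (g_inv v k e t h x))
          * inverse \<bar>det (velocity_matrix v k e)\<bar>
          * \<P>(\<omega> in M. duration_count U k (t - (\<Sum>h\<in>{..CARD('n)} - {k}. g_inv v k e t h x)) \<omega>
                       = enat (n k - 1))
          * \<P>(\<omega> in M. (\<forall>h\<le>CARD('n). allocation W V (v h) (\<Sum>i\<le>CARD('n). n i) \<omega> = n h)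
                       \<and> step_velocity W V ((\<Sum>i\<le>CARD('n). n i) - 1) \<omega> = v k)) \<partial>lborel)"
proof -
  note t = \<open>0 \<le> t\<close> and n_pos = assms(5) and k = \<open>k \<le> CARD('n)\<close>
    and f_pos = density_nonneg and f_density = density
    and e = \<open>bij_betw e UNIV ({..CARD('n)} - {k})\<close>
  note B [measurable] = \<open>B \<in> sets borel\<close>
  interpret minimal_random_motion_independent M v W V U
    by (rule motion)
  let ?A = "velocity_matrix v k e"
  let ?G = "\<lambda>y. t *\<^sub>R v k + ?A *v y"
  let ?f = "\<lambda>y. \<Prod>i\<in>UNIV. f (e i) (n (e i)) (y $ i)"
  define p where "p s = \<P>(\<omega> in M. duration_sum U k (n k - 1) \<omega> \<le> s
      \<and> s < duration_sum U k (n k) \<omega>)" for s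
  define q where "q = \<P>(\<omega> in M. (\<forall>h\<le>CARD('n). allocation W V (v h) (\<Sum>i\<le>CARD('n). n i) \<omega> = n h)
      \<and> step_velocity W V ((\<Sum>i\<le>CARD('n). n i) - 1) \<omega> = v k)"
  have inj_e: "inj e" and range_e: "range e \<subseteq> {..CARD('n)} - {k}"
    using e by (auto simp: bij_betw_def)
  then have e_le: "e i \<le> CARD('n)" for i
    by auto
  have n_e: "1 \<le> n (e i)" for i
    using n_pos e_le by blast
  have det: "det ?A \<noteq> 0"
    using det_velocity_matrix_nonzero[OF v_inj v_affine_independent k e] .
  have g_inv: "g_inv v k e t (e i) (?G y) = y $ i" for i y
    by (rule g_inv_velocity_matrix[OF inj_e det])
  have reindex: "(\<Sum>h\<in>{..CARD('n)} - {k}. F h) = (\<Sum>i\<in>UNIV. F (e i))"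
    and reindex_prod: "(\<Prod>h\<in>{..CARD('n)} - {k}. F h) = (\<Prod>i\<in>UNIV. F (e i))" for F :: "nat \<Rightarrow> real"
    by (rule sum.reindex_bij_betw[OF e, symmetric] prod.reindex_bij_betw[OF e, symmetric])+
  have f_nonneg: "0 \<le> f (e i) (n (e i)) x" for i x
    by (rule f_pos[OF e_le n_e])
  have [measurable]: "f (e i) (n (e i)) \<in> borel_measurable borel" for i
    using distributed_real_measurable[OF _ f_density[OF e_le n_e]] f_nonneg by simp
  have [measurable]: "(\<lambda>s. ennreal (p s)) \<in> borel_measurable borel"
    unfolding p_def by (intro measurable_prob_between duration_sum_measurable k)
  have [measurable]: "g_inv v k e t h \<in> borel_measurable borel" for h
    unfolding g_inv_def[abs_def] by measurable
  have p_nonneg: "0 \<le> p s" for s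
    by (simp add: p_def)
  have count: "\<P>(\<omega> in M. duration_count U k s \<omega> = enat (n k - 1)) = p s" if "0 \<le> s" for s
    using prob_duration_count[OF k that, of "n k - 1"] n_pos[OF k] by (simp add: p_def)

  have C: "{y. ?G y \<in> B} \<in> sets borel"
    by measurable
  have "ennreal (\<P>(\<omega> in M. position V t \<omega> \<in> B
      \<and> (\<forall>h\<le>CARD('n). displacements W V (v h) t \<omega> = n h) \<and> V t \<omega> = v k))
    = (\<integral>\<^sup>+y. ennreal (?f y) * (indicator {y. ?G y \<in> B} y * ennreal (p (t - (\<Sum>i\<in>UNIV. y $ i)))) \<partial>lborel)
      * ennreal q"
    using prob_durations_density[OF k inj_e range_e f_nonneg f_density[OF e_le n_e] C,
      of "n k - 1" t "n k", folded p_def]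
    by (simp add: prob_motion_event[where n = n, OF t k n_pos[OF k] e B] q_def ennreal_mult)
  then have event: "ennreal (\<P>(\<omega> in M. position V t \<omega> \<in> B
      \<and> (\<forall>h\<le>CARD('n). displacements W V (v h) t \<omega> = n h) \<and> V t \<omega> = v k))
    = (\<integral>\<^sup>+y. ennreal (?f y) * (indicator B (?G y) * ennreal (p (t - (\<Sum>i\<in>UNIV. y $ i)))) * ennreal q
        \<partial>lborel)"
    by (simp add: nn_integral_multc indicator_def)

  (* F is the integrand of the claim, with the count replaced by the two duration sums around it; the
     change of variables x = ?G y turns it into the integrand above. *)
  define F where "F x = ennreal (?f (\<chi> i. g_inv v k e t (e i) x)) * ennreal (inverse \<bar>det ?A\<bar>)
      * ennreal (p (t - (\<Sum>i\<in>UNIV. g_inv v k e t (e i) x))) * ennreal q * indicator B x" for x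
  have F_meas [measurable]: "F \<in> borel_measurable borel"
    unfolding F_def[abs_def] by measurable
  have F_G: "ennreal \<bar>det ?A\<bar> * F (?G y) = ennreal (?f y)
      * (indicator B (?G y) * ennreal (p (t - (\<Sum>i\<in>UNIV. y $ i)))) * ennreal q" for y
  proof -
    have "ennreal \<bar>det ?A\<bar> * F (?G y) = (ennreal \<bar>det ?A\<bar> * ennreal (inverse \<bar>det ?A\<bar>)) *
        (ennreal (?f y) * (indicator B (?G y) * ennreal (p (t - (\<Sum>i\<in>UNIV. y $ i)))) * ennreal q)"
      by (simp add: F_def g_inv ac_simps)
    moreover have "ennreal \<bar>det ?A\<bar> * ennreal (inverse \<bar>det ?A\<bar>) = 1"
      using det by (simp add: ennreal_mult[symmetric])
    ultimately show ?thesis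
      by simp
  qed
  have "(\<integral>\<^sup>+x\<in>B. ennreal (
          (\<Prod>h\<in>{..CARD('n)} - {k}. f h (n h) (g_inv v k e t h x))
          * inverse \<bar>det (velocity_matrix v k e)\<bar>
          * \<P>(\<omega> in M. duration_count U k (t - (\<Sum>h\<in>{..CARD('n)} - {k}. g_inv v k e t h x)) \<omega>
                       = enat (n k - 1))
          * \<P>(\<omega> in M. (\<forall>h\<le>CARD('n). allocation W V (v h) (\<Sum>i\<le>CARD('n). n i) \<omega> = n h)
                       \<and> step_velocity W V ((\<Sum>i\<le>CARD('n). n i) - 1) \<omega> = v k)) \<partial>lborel)
    = (\<integral>\<^sup>+x. F x \<partial>lborel)"
  proof (rule nn_integral_cong)
    fix x
    show "ennreal (
          (\<Prod>h\<in>{..CARD('n)} - {k}. f h (n h) (g_inv v k e t h x))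
          * inverse \<bar>det (velocity_matrix v k e)\<bar>
          * \<P>(\<omega> in M. duration_count U k (t - (\<Sum>h\<in>{..CARD('n)} - {k}. g_inv v k e t h x)) \<omega>
                       = enat (n k - 1))
          * \<P>(\<omega> in M. (\<forall>h\<le>CARD('n). allocation W V (v h) (\<Sum>i\<le>CARD('n). n i) \<omega> = n h)
                       \<and> step_velocity W V ((\<Sum>i\<le>CARD('n). n i) - 1) \<omega> = v k))
          * indicator B x = F x"
    proof (cases "x \<in> B")
      case True
      then have "x \<in> convex hull ((\<lambda>h. t *\<^sub>R v h) ` {..CARD('n)})"
        using assms(9) interior_subset by blast
      then obtain y where "x = ?G y" "(\<Sum>i\<in>UNIV. y $ i) \<le> t"
        by (rule convex_hull_coordinates[OF e t])
      then have "0 \<le> t - (\<Sum>i\<in>UNIV. g_inv v k e t (e i) x)"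
        by (simp add: g_inv)
      from count[OF this] show ?thesis
        using True
        by (simp add: F_def reindex reindex_prod ennreal_mult' prod_nonneg f_nonneg p_nonneg q_def)
    qed (simp add: F_def)
  qed
  also have "\<dots> = ennreal \<bar>det ?A\<bar> * (\<integral>\<^sup>+y. F (?G y) \<partial>lborel)"
    by (rule nn_integral_lborel_affine[OF det F_meas])
  also have "\<dots> = (\<integral>\<^sup>+y. ennreal \<bar>det ?A\<bar> * F (?G y) \<partial>lborel)"
    by (intro nn_integral_cmult[symmetric]) measurable
  also have "\<dots> = ennreal (\<P>(\<omega> in M. position V t \<omega> \<in> B
      \<and> (\<forall>h\<le>CARD('n). displacements W V (v h) t \<omega> = n h) \<and> V t \<omega> = v k))"
    unfolding F_G event ..
  finally show ?thesis
    by (rule sym)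
qed

end
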